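(* Suppose $f_0\colon\mathbb{H}^n\to \mathbb{R}$ is a Lipschitz function, $(x_0,E_0)\in D^{f_0}$ and $\delta_0, \mu, K>0$. Then there is a Lipschitz function $f\colon\mathbb{H}^n\to \mathbb{R}$ such that $f-f_0$ is $\mathbb{H}$-linear with $\mathrm{Lip}_{\mathbb{H}}(f-f_{0})\leq \mu$, and a pair $(x_{\ast},E_{\ast})\in D^{f}$ with $d(x_{\ast},x_0)\leq \delta_0$ such that $E_{\ast}f(x_{\ast})>0$ is almost locally maximal in the following sense. For any $\varepsilon>0$ there is $\delta_{\varepsilon}>0$ such that whenever $(x,E)\in D^{f}$ satisfies both: (1) $d(x,x_{\ast})\leq \delta_{\varepsilon}$ and $Ef(x)\geq E_{\ast}f(x_{\ast})$, (2) for any $t\in (-1,1)$: \[|(f(x+tE_{\ast}(x))-f(x))-(f(x_{\ast}+tE_{\ast}(x_{\ast}))-f(x_{\ast}))| \leq K|t| ( Ef(x)-E_{\ast}f(x_{\ast}))^{\frac{1}{4}},\] then $Ef(x)<E_{\ast}f(x_{\ast})+\varepsilon$.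
   Context: Fix an integer $n\geq 1$. The Heisenberg group $\mathbb{H}^n$ is $\mathbb{R}^{2n+1}$, with points written $(a,b,c)$, $a,b\in\mathbb{R}^n$, $c\in\mathbb{R}$, equipped with the group law $(a,b,c)(a',b',c')=(a+a',b+b',c+c'-2(\langle a,b'\rangle-\langle b,a'\rangle))$. Dilations are $\delta_r(a,b,c)=(ra,rb,r^2c)$ for $r>0$. For $1\le i\le n$ define vector fields $X_i(a,b,c)=e_i+2b_ie_{2n+1}$, $Y_i(a,b,c)=e_{n+i}-2a_ie_{2n+1}$, where $e_1,\dots,e_{2n+1}$ is the standard basis. $V=\mathrm{Span}\{X_i,Y_i:1\le i\le n\}$ and $\omega$ is the inner product norm on $V$ making $\{X_i,Y_i\}$ orthonormal. An absolutely continuous curve $\gamma\colon I\to\mathbb{H}^n$ ($I\subset\mathbb{R}$ an interval) is horizontal if there is $h\colon I\to\mathbb{R}^{2n}$ with $\gamma'(t)=\sum_{i=1}^n(h_i(t)X_i(\gamma(t))+h_{n+i}(t)Y_i(\gamma(t)))$ for a.e. $t\in I$; its horizontal length is $L_{\mathbb{H}}(\gamma)=\int_I|h|$. The Carnot-Carathéodory distance is $d(x,y)=\inf\{L_{\mathbb{H}}(\gamma):\gamma \text{ a horizontal curve joining } x \text{ to } y\}$. "Lipschitz" is with respect to $d$ when the domain or target is $\mathbb{H}^n$, and $\mathrm{Lip}_{\mathbb{H}}$ is the corresponding Lipschitz constant. For $f\colon\mathbb{H}^n\to\mathbb{R}$ Lipschitz and $E\in V$, $Ef(x):=(f\circ\gamma)'(t)$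 whenever it exists, where $\gamma$ is any Lipschitz horizontal curve with $\gamma(t)=x$ and $\gamma'(t)=E(x)$ (independent of the choice of $\gamma$; e.g. $Ef(x)=\lim_{t\to0}(f(x+tE(x))-f(x))/t$). $N\subset\mathbb{H}^n$ is a fixed Lebesgue measure zero $G_\delta$ set containing all (entire) straight lines which are also horizontal curves and join pairs of points of $\mathbb{Q}^{2n+1}$. For Lipschitz $f\colon\mathbb{H}^n\to\mathbb{R}$, $D^f:=\{(x,E)\in N\times V:\omega(E)=1,\ Ef(x)\text{ exists}\}$. A function $L\colon\mathbb{H}^n\to\mathbb{R}$ is $\mathbb{H}$-linear if $L(xy)=L(x)+L(y)$ and $L(\delta_r(x))=rL(x)$ for all $x,y\in\mathbb{H}^n$, $r>0$. *)

theory Defs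
  imports "HOL-Analysis.Analysis"
begin

(* The Heisenberg group of dimension 2n+1 with n = CARD('n); a point is a triple (a, b, c).
   The topology, norm and Lebesgue measure of this product type are the Euclidean ones, so that
   the library's dist is never the Carnot-Caratheodory distance. *)
type_synonym 'n heis = "(real, 'n) vec \<times> (real, 'n) vec \<times> real"

fun hmult :: "'n::finite heis \<Rightarrow> 'n heis \<Rightarrow> 'n heis" where
  "hmult (a, b, c) (a', b', c') = (a + a', b + b', c + c' - 2 * (a \<bullet> b' - b \<bullet> a'))"

fun hdil :: "real \<Rightarrow> 'n::finite heis \<Rightarrow> 'n heis" where
  "hdil r (a, b, c) = (r *\<^sub>R a, r *\<^sub>R b, r\<^sup>2 * c)"

fun X_field :: "'n::finite \<Rightarrow> 'n heis \<Rightarrow> 'n heis" where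
  "X_field i (a, b, c) = (axis i 1, 0, 2 * b $ i)"

fun Y_field :: "'n::finite \<Rightarrow> 'n heis \<Rightarrow> 'n heis" where
  "Y_field i (a, b, c) = (0, axis i 1, - 2 * a $ i)"

(* A coefficient vector in R^(2n) is a pair (u, v); the norm of this product type is the
   Euclidean norm of R^(2n). *)
definition hfield :: "(real, 'n::finite) vec \<times> (real, 'n) vec \<Rightarrow> 'n heis \<Rightarrow> 'n heis" where
  "hfield h p = (\<Sum>i\<in>UNIV. fst h $ i *\<^sub>R X_field i p + snd h $ i *\<^sub>R Y_field i p)"

(* The span of the X_i and Y_i, as vector fields. *)
definition V_fields :: "('n::finite heis \<Rightarrow> 'n heis) set" where
  "V_fields = range hfield"

definition hcoeffs :: "('n::finite heis \<Rightarrow> 'n heis) \<Rightarrow> (real, 'n) vec \<times> (real, 'n) vec" where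
  "hcoeffs E = (THE h. E = hfield h)"

definition omega :: "('n::finite heis \<Rightarrow> 'n heis) \<Rightarrow> real" where
  "omega E = norm (hcoeffs E)"

lemma hfield_Pair: "hfield (u, v) (a, b, c) = (u, v, 2 * (u \<bullet> b - v \<bullet> a))"
proof -
  have 1: "(\<Sum>i\<in>UNIV. w $ i *\<^sub>R axis i 1) = w" for w :: "real^'n"
    using basis_expansion[of w] by (simp add: scalar_mult_eq_scaleR)
  have "hfield (u, v) (a, b, c) =
      (\<Sum>i\<in>UNIV. (u $ i *\<^sub>R axis i 1, v $ i *\<^sub>R axis i 1, 2 * (u $ i * b $ i - v $ i * a $ i)))"
    by (simp add: hfield_def algebra_simps)
  also have "\<dots> = (u, v, 2 * (u \<bullet> b - v \<bullet> a))"
    by (simp add: sum_prod 1 sum_distrib_left[symmetric] sum_subtractf inner_vec_def)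
  finally show ?thesis .
qed

lemma hcoeffs_hfield: "hcoeffs (hfield h) = (h :: (real, 'n::finite) vec \<times> (real, 'n) vec)"
  unfolding hcoeffs_def
proof (rule the_equality)
  fix k :: "(real, 'n) vec \<times> (real, 'n) vec" assume eq: "hfield h = hfield k"
  have "fst (hfield g 0) = fst g \<and> fst (snd (hfield g 0)) = snd g"
    for g :: "(real, 'n) vec \<times> (real, 'n) vec"
    using hfield_Pair[of "fst g" "snd g" 0 0 0] by (simp add: zero_prod_def)
  then show "k = h"
    by (metis eq prod_eqI)
qed simp

(* The norm of the inner product for which the X_i, Y_i are orthonormal. *)
lemma omega_hfield: "omega (hfield (u, v)) = sqrt ((\<Sum>i\<in>UNIV. (u $ i)\<^sup>2) + (\<Sum>i\<in>UNIV. (v $ i)\<^sup>2))"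
  by (simp add: omega_def hcoeffs_hfield norm_Pair norm_vec_def L2_set_def sum_nonneg)

definition absolutely_continuous_curve :: "real set \<Rightarrow> (real \<Rightarrow> 'a::metric_space) \<Rightarrow> bool" where
  "absolutely_continuous_curve I \<gamma> \<longleftrightarrow>
    (\<forall>\<epsilon>>0. \<exists>\<delta>>0. \<forall>D.
      finite D \<and> (\<forall>(s, t)\<in>D. s \<in> I \<and> t \<in> I \<and> s < t) \<and>
      pairwise (\<lambda>(s, t) (s', t'). t \<le> s' \<or> t' \<le> s) D \<and>
      (\<Sum>(s, t)\<in>D. t - s) < \<delta> \<longrightarrow>
      (\<Sum>(s, t)\<in>D. dist (\<gamma> s) (\<gamma> t)) < \<epsilon>)"

definition horizontal_with ::
  "real set \<Rightarrow> (real \<Rightarrow> 'n::finite heis) \<Rightarrow> (real \<Rightarrow> (real, 'n) vec \<times> (real, 'n) vec) \<Rightarrow> bool" where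
  "horizontal_with I \<gamma> h \<longleftrightarrow>
    is_interval I \<and> absolutely_continuous_curve I \<gamma> \<and>
    (AE t in lebesgue. t \<in> I \<longrightarrow>
      (\<gamma> has_vector_derivative hfield (h t) (\<gamma> t)) (at t within I))"

definition horizontal_curve :: "real set \<Rightarrow> (real \<Rightarrow> 'n::finite heis) \<Rightarrow> bool" where
  "horizontal_curve I \<gamma> \<longleftrightarrow> (\<exists>h. horizontal_with I \<gamma> h)"

(* The horizontal lengths of the horizontal curves joining x to y.  The function h is determined
   by the curve almost everywhere on the interval, hence so is the length. *)
definition hlengths :: "'n::finite heis \<Rightarrow> 'n heis \<Rightarrow> real set" where
  "hlengths x y =
    {LINT t:{a..b}|lebesgue. norm (h t) | a b \<gamma> h.
      a \<le> b \<and> horizontal_with {a..b} \<gamma> h \<and> \<gamma> a = x \<and> \<gamma> b = y}"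

definition ccdist :: "'n::finite heis \<Rightarrow> 'n heis \<Rightarrow> real" where
  "ccdist x y = Inf (hlengths x y)"

definition Lipschitz_fun :: "('n::finite heis \<Rightarrow> real) \<Rightarrow> bool" where
  "Lipschitz_fun f \<longleftrightarrow> (\<exists>C\<ge>0. \<forall>x y. \<bar>f x - f y\<bar> \<le> C * ccdist x y)"

definition Lip_H :: "('n::finite heis \<Rightarrow> real) \<Rightarrow> real" where
  "Lip_H f = Inf {C. 0 \<le> C \<and> (\<forall>x y. \<bar>f x - f y\<bar> \<le> C * ccdist x y)}"

definition Lipschitz_curve :: "real set \<Rightarrow> (real \<Rightarrow> 'n::finite heis) \<Rightarrow> bool" where
  "Lipschitz_curve I \<gamma> \<longleftrightarrow> (\<exists>C\<ge>0. \<forall>s\<in>I. \<forall>t\<in>I. ccdist (\<gamma> s) (\<gamma> t) \<le> C * \<bar>s - t\<bar>)"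

(* Ef(x) exists and equals D.  For Lipschitz f neither depends on the choice of the curve.
   The parameter is interior to the interval so that the derivatives are two-sided and determined
   by the curve on its domain. *)
definition has_hderiv ::
  "('n::finite heis \<Rightarrow> real) \<Rightarrow> ('n heis \<Rightarrow> 'n heis) \<Rightarrow> 'n heis \<Rightarrow> real \<Rightarrow> bool" where
  "has_hderiv f E x D \<longleftrightarrow>
    (\<exists>I \<gamma> t. horizontal_curve I \<gamma> \<and> Lipschitz_curve I \<gamma> \<and> t \<in> interior I \<and> \<gamma> t = x \<and>
      (\<gamma> has_vector_derivative E x) (at t) \<and>
      ((f \<circ> \<gamma>) has_real_derivative D) (at t))"

definition hderiv :: "('n::finite heis \<Rightarrow> real) \<Rightarrow> ('n heis \<Rightarrow> 'n heis) \<Rightarrow> 'n heis \<Rightarrow> real" where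
  "hderiv f E x = (THE D. has_hderiv f E x D)"

definition D_set ::
  "'n::finite heis set \<Rightarrow> ('n heis \<Rightarrow> real) \<Rightarrow> ('n heis \<times> ('n heis \<Rightarrow> 'n heis)) set" where
  "D_set N f = {(x, E). x \<in> N \<and> E \<in> V_fields \<and> omega E = 1 \<and> (\<exists>D. has_hderiv f E x D)}"

definition H_linear :: "('n::finite heis \<Rightarrow> real) \<Rightarrow> bool" where
  "H_linear L \<longleftrightarrow>
    (\<forall>x y. L (hmult x y) = L x + L y) \<and> (\<forall>r>0. \<forall>x. L (hdil r x) = r * L x)"

definition rational_points :: "'n::finite heis set" where
  "rational_points = {(a, b, c). (\<forall>i. a $ i \<in> \<rat>) \<and> (\<forall>i. b $ i \<in> \<rat>) \<and> c \<in> \<rat>}"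

definition contains_rational_horizontal_lines :: "'n::finite heis set \<Rightarrow> bool" where
  "contains_rational_horizontal_lines N \<longleftrightarrow>
    (\<forall>p\<in>rational_points. \<forall>q\<in>rational_points.
      p \<noteq> q \<and> horizontal_curve UNIV (\<lambda>t. p + t *\<^sub>R (q - p)) \<longrightarrow>
      range (\<lambda>t. p + t *\<^sub>R (q - p)) \<subseteq> N)"

end

theory Submission
  imports Defs
begin

text \<open>
  Write a horizontal direction as \<open>hfield u\<close> with \<open>u\<close> in the unit sphere of \<open>\<real>\<^sup>2\<^sup>n\<close> and let \<open>\<phi> x u\<close> be
  the derivative of \<open>f0\<close> at \<open>x\<close> in this direction. The functions \<open>f\<close> considered are
  \<open>f0 + L \<bullet> hproj\<close>, where \<open>hproj\<close> drops the vertical coordinate; these perturbations are linear for the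
  group structure, have Lipschitz constant at most \<open>norm L\<close>, and replace \<open>\<phi> x u\<close> by
  \<open>\<phi> x u + L \<bullet> u\<close>. They neither change the set of pairs at which the derivative exists nor the
  differences of increments that occur in the comparison condition of the theorem. The problem
  therefore becomes a variational principle for the partial function \<open>\<phi>\<close>: find a small \<open>L\<close> such that \<open>\<phi> x u + L \<bullet> u\<close> has an almost local
  maximum, relative to the comparison condition. It is solved in \<open>almost_locally_maximal_direction\<close>
  by adding, step by step, multiples of \<open>U k \<bullet> u\<close>, where \<open>U k\<close> is the direction chosen at step \<open>k\<close>. On
  the sphere such a summand is, up to a constant, a quadratic penalty for leaving \<open>U k\<close>, so the
  directions converge; closeness of increments, demanded relative to all earlier steps, makes the
  derivative exist at the limit. The modulus \<open>K * s powr (1/4)\<close> grows strictly with the gain \<open>s\<close> of slope,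
  which leaves room to compare a nearby pair of larger slope with all earlier steps.

  To apply the principle one needs the increments of \<open>f0\<close> along horizontal lines to be uniformly
  continuous in the direction, relative to \<open>\<bar>t\<bar>\<close>, and continuous in the point. Both follow from an estimate
  for the Carnot-Caratheodory distance by left-invariant coordinates: up to constants, the distance from
  \<open>p\<close> to \<open>q\<close> is the norm of \<open>hproj q - hproj p\<close> plus the square root of the absolute value of \<open>vgap p q\<close>,
  the last coordinate of \<open>p\<inverse>q\<close>. The upper bound (\<open>horizontal_connection\<close>) comes from an explicit curve,
  the lower bound (\<open>ccdist_lower\<close>) from integrating the derivative of a horizontal curve, which requires the
  fundamental theorem of calculus for absolutely continuous functions. The same theorem shows that a
  Lipschitz horizontal curve stays close to its tangent line for the Carnot-Caratheodory distance; so the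
  horizontal derivative of a Lipschitz function, defined with arbitrary curves, is its derivative along
  a straight line (\<open>has_hderiv_iff\<close>).
\<close>

section \<open>Absolutely continuous curves\<close>

lemma absolutely_continuous_curve_iff:
  "absolutely_continuous_curve I F \<longleftrightarrow>
    (\<forall>e>0. \<exists>\<delta>>0. \<forall>D. finite D \<longrightarrow>
      (\<forall>(s, t)\<in>D. s \<in> I \<and> t \<in> I \<and> s < t) \<longrightarrow>
      pairwise (\<lambda>(s, t) (s', t'). t \<le> s' \<or> t' \<le> s) D \<longrightarrow>
      (\<Sum>(s, t)\<in>D. t - s) < \<delta> \<longrightarrow> (\<Sum>(s, t)\<in>D. dist (F s) (F t)) < e)"
  unfolding absolutely_continuous_curve_def by (simp only: imp_conjL)

lemma absolutely_continuous_curve_subset: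
  assumes "absolutely_continuous_curve I F" "J \<subseteq> I"
  shows "absolutely_continuous_curve J F"
  unfolding absolutely_continuous_curve_iff
proof (intro allI impI)
  fix e :: real assume "e > 0"
  then obtain \<delta> where "\<delta> > 0" and \<delta>: "\<forall>D. finite D \<longrightarrow>
      (\<forall>(s, t)\<in>D. s \<in> I \<and> t \<in> I \<and> s < t) \<longrightarrow>
      pairwise (\<lambda>(s, t) (s', t'). t \<le> s' \<or> t' \<le> s) D \<longrightarrow>
      (\<Sum>(s, t)\<in>D. t - s) < \<delta> \<longrightarrow> (\<Sum>(s, t)\<in>D. dist (F s) (F t)) < e"
    using assms(1) unfolding absolutely_continuous_curve_iff by blast
  show "\<exists>\<delta>>0. \<forall>D. finite D \<longrightarrow>
      (\<forall>(s, t)\<in>D. s \<in> J \<and> t \<in> J \<and> s < t) \<longrightarrow>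
      pairwise (\<lambda>(s, t) (s', t'). t \<le> s' \<or> t' \<le> s) D \<longrightarrow>
      (\<Sum>(s, t)\<in>D. t - s) < \<delta> \<longrightarrow> (\<Sum>(s, t)\<in>D. dist (F s) (F t)) < e"
    using \<open>\<delta> > 0\<close> assms(2) by (intro exI[of _ \<delta>] conjI allI impI \<delta>[rule_format]) auto
qed

text \<open>
  The definition speaks of finite families of pairs of points; integration theory works with
  divisions into compact intervals. Degenerate intervals contribute nothing; they are dropped because
  the definition asks for distinct points in each pair.
\<close>

lemma absolutely_continuous_division:
  fixes F :: "real \<Rightarrow> 'a::real_normed_vector"
  assumes "absolutely_continuous_curve I F" and "e > 0"
  obtains \<delta> where "\<delta> > 0"
    and "\<And>d S. \<lbrakk>d division_of S; S \<subseteq> I; sum (measure lborel) d < \<delta>\<rbrakk>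
      \<Longrightarrow> (\<Sum>K\<in>d. norm (F (Sup K) - F (Inf K))) < e"
proof -
  obtain \<delta> where "\<delta> > 0" and \<delta>: "\<forall>D. finite D \<longrightarrow>
      (\<forall>(s, t)\<in>D. s \<in> I \<and> t \<in> I \<and> s < t) \<longrightarrow>
      pairwise (\<lambda>(s, t) (s', t'). t \<le> s' \<or> t' \<le> s) D \<longrightarrow>
      (\<Sum>(s, t)\<in>D. t - s) < \<delta> \<longrightarrow> (\<Sum>(s, t)\<in>D. dist (F s) (F t)) < e"
    using assms unfolding absolutely_continuous_curve_iff by blast
  have "(\<Sum>K\<in>d. norm (F (Sup K) - F (Inf K))) < e"
    if d: "d division_of S" "S \<subseteq> I" "sum (measure lborel) d < \<delta>" for d S
  proof -
    define d' where "d' = {K\<in>d. Inf K < Sup K}"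
    have fin: "finite d" using d(1) by blast
    have K: "\<exists>u v. K = {u..v} \<and> u \<le> v \<and> Inf K = u \<and> Sup K = v" if "K \<in> d" for K
    proof -
      obtain u v where "K = {u..v}" "K \<noteq> {}" using division_ofD(3,4)[OF d(1) \<open>K \<in> d\<close>] by auto
      then show ?thesis by (intro exI[of _ u] exI[of _ v]) auto
    qed
    have inj: "inj_on (\<lambda>K. (Inf K, Sup K)) d'"
    proof (rule inj_onI)
      fix L M assume "L \<in> d'" "M \<in> d'" "(Inf L, Sup L) = (Inf M, Sup M)"
      then show "L = M" using K[of L] K[of M] by (auto simp: d'_def)
    qed
    let ?D = "(\<lambda>K. (Inf K, Sup K)) ` d'"
    have "(\<Sum>(s, t)\<in>?D. dist (F s) (F t)) < e"
    proof (rule \<delta>[rule_format])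
      show "finite ?D" using fin by (simp add: d'_def)
      show "case x of (s, t) \<Rightarrow> s \<in> I \<and> t \<in> I \<and> s < t" if "x \<in> ?D" for x
      proof -
        { fix L assume L: "L \<in> d'"
          then obtain u v where "L = {u..v}" "u \<le> v" "Inf L = u" "Sup L = v" using K d'_def by blast
          moreover have "L \<subseteq> I" using division_ofD(2)[OF d(1)] d(2) L d'_def by blast
          ultimately have "Inf L \<in> I \<and> Sup L \<in> I \<and> Inf L < Sup L" using L by (auto simp: d'_def) }
        then show ?thesis using that by auto
      qed
      show "pairwise (\<lambda>(s, t) (s', t'). t \<le> s' \<or> t' \<le> s) ?D"
      proof -
        { fix L M assume L: "L \<in> d'" "M \<in> d'" "L \<noteq> M"
          then obtain u v u' v' where uv: "L = {u..v}" "Inf L = u" "Sup L = v" "M = {u'..v'}" "Inf M = u'" "Sup M = v'"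
            using K[of L] K[of M] by (auto simp: d'_def)
          have "{u<..<v} \<inter> {u'<..<v'} = {}"
            using division_ofD(5)[OF d(1), of L M] L uv by (auto simp: d'_def)
          moreover have "u < v" "u' < v'" using L uv by (auto simp: d'_def)
          ultimately have "Sup L \<le> Inf M \<or> Sup M \<le> Inf L" using uv by auto }
        then show ?thesis unfolding pairwise_def by (auto; metis)
      qed
      have "(\<Sum>(s, t)\<in>?D. t - s) = (\<Sum>K\<in>d'. Sup K - Inf K)"
        using inj by (simp add: sum.reindex)
      also have "\<dots> = (\<Sum>K\<in>d'. measure lborel K)"
        by (intro sum.cong refl) (auto simp: d'_def dest: K)
      also have "\<dots> \<le> sum (measure lborel) d"
        using fin by (intro sum_mono2) (auto simp: d'_def)
      finally show "(\<Sum>(s, t)\<in>?D. t - s) < \<delta>" using d(3) by simp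
    qed
    also have "(\<Sum>(s, t)\<in>?D. dist (F s) (F t)) = (\<Sum>K\<in>d'. norm (F (Sup K) - F (Inf K)))"
      using inj by (simp add: sum.reindex dist_norm norm_minus_commute)
    also have "\<dots> = (\<Sum>K\<in>d. norm (F (Sup K) - F (Inf K)))"
    proof (rule sum.mono_neutral_left)
      show "\<forall>i\<in>d - d'. norm (F (Sup i) - F (Inf i)) = 0"
        using K d'_def by fastforce
    qed (use fin d'_def in auto)
    finally show ?thesis .
  qed
  then show ?thesis using \<open>\<delta> > 0\<close> that by blast
qed

text \<open>
  The fundamental theorem of calculus for the gauge integral, with an exceptional null set \<open>Z\<close>. Off
  \<open>Z\<close> the gauge comes from differentiability, as in the classical proof. At a tag in \<open>Z\<close> the gauge is
  an open set of small measure around \<open>Z\<close>: the intervals with such tags have small total length, so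
  absolute continuity makes the total increment of \<open>F\<close> over them small.
\<close>

theorem absolutely_continuous_has_integral:
  fixes F :: "real \<Rightarrow> 'a::euclidean_space"
  assumes "a \<le> b" and AC: "absolutely_continuous_curve {a..b} F" and Z: "negligible Z"
    and deriv: "\<And>t. t \<in> {a..b} - Z \<Longrightarrow> (F has_vector_derivative f t) (at t within {a..b})"
  shows "(f has_integral (F b - F a)) {a..b}"
proof -
  define g where "g t = (if t \<in> Z then 0 else f t)" for t
  have "(g has_integral (F b - F a)) {a..b}"
    unfolding has_integral_factor_content_real
  proof (intro allI impI)
    fix e :: real assume "e > 0"
    show "\<exists>d. gauge d \<and> (\<forall>p. p tagged_division_of {a..b} \<and> d fine p \<longrightarrow>
        norm ((\<Sum>(x, k)\<in>p. measure lborel k *\<^sub>R g x) - (F b - F a)) \<le> e * measure lborel {a..b})"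
    proof (cases "a < b")
      case False
      then have "a = b" using \<open>a \<le> b\<close> by simp
      have "norm ((\<Sum>(x, k)\<in>p. measure lborel k *\<^sub>R g x) - (F b - F a)) \<le> e * measure lborel {a..b}"
        if p: "p tagged_division_of {a..b}" for p
      proof -
        have "measure lborel k = 0" if "(x,k) \<in> p" for x k
        proof -
          have "k \<subseteq> {a..a}" using tagged_division_ofD(3)[OF p that] \<open>a = b\<close> by simp
          moreover obtain u v where "k = {u..v}" using tagged_division_ofD(4)[OF p \<open>(x,k) \<in> p\<close>] by auto
          ultimately have "u = a \<and> v = a" if "u \<le> v"
            using that subsetD[of k "{a..a}" u] subsetD[of k "{a..a}" v] by auto
          then show ?thesis using \<open>k = {u..v}\<close> by (cases "u \<le> v") auto
        qed
        then have "(\<Sum>(x, k)\<in>p. measure lborel k *\<^sub>R g x) = 0" by (intro sum.neutral) auto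
        then show ?thesis using \<open>a = b\<close> by simp
      qed
      then show ?thesis by (intro exI[of _ "\<lambda>x. ball x 1"]) auto
    next
      case True
      define c where "c = e/2"
      have "c > 0" "c * (b - a) > 0" using \<open>e > 0\<close> True by (auto simp: c_def)
      obtain \<delta> where "\<delta> > 0" and \<delta>: "\<And>d S. \<lbrakk>d division_of S; S \<subseteq> {a..b}; sum (measure lborel) d < \<delta>\<rbrakk>
            \<Longrightarrow> (\<Sum>K\<in>d. norm (F (Sup K) - F (Inf K))) < c * (b - a)"
        using absolutely_continuous_division[OF AC \<open>c * (b - a) > 0\<close>] by metis
      \<comment> \<open>an open cover of the null set, so thin that absolute continuity applies to intervals inside it\<close>
      obtain G where G: "open G" "Z \<subseteq> G" "G - Z \<in> lmeasurable" "emeasure lebesgue (G - Z) < ennreal \<delta>"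
        using sets_lebesgue_outer_open[OF negligible_imp_sets[OF Z] \<open>\<delta> > 0\<close>] by metis
      have Gm: "G \<in> lmeasurable"
        using G(2,3) Z by (metis Diff_partition fmeasurable.Un negligible_imp_measurable)
      have "measure lebesgue (G - Z) = measure lebesgue G"
        using Z by (simp add: measure_Diff_null_set negligible_iff_null_sets Gm fmeasurableD)
      then have Gd: "measure lebesgue G < \<delta>"
        using G(3,4) \<open>\<delta> > 0\<close> by (metis emeasure_eq_measure2 ennreal_less_iff measure_nonneg)
      have "\<forall>x. \<exists>r>0. x \<in> {a..b} - Z \<longrightarrow> (\<forall>y\<in>{a..b}. norm (y-x) < r \<longrightarrow> norm (F y - F x - (y-x) *\<^sub>R f x) \<le> c * norm (y-x))"
        using deriv[unfolded has_vector_derivative_def has_derivative_within_alt] \<open>c > 0\<close> zero_less_one by blast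
      then obtain r where r: "\<And>x. 0 < r x"
         "\<And>x y. \<lbrakk>x \<in> {a..b} - Z; y \<in> {a..b}; norm (y-x) < r x\<rbrakk> \<Longrightarrow> norm (F y - F x - (y-x) *\<^sub>R f x) \<le> c * norm (y-x)"
        by metis
      define d where "d x = (if x \<in> Z then G else ball x (r x))" for x
      have "gauge d"
        using G r by (auto simp: gauge_def d_def)
      moreover have "norm ((\<Sum>(x, k)\<in>p. measure lborel k *\<^sub>R g x) - (F b - F a)) \<le> e * measure lborel {a..b}"
        if p: "p tagged_division_of {a..b}" and fine: "d fine p" for p
      proof -
        have finp: "finite p" using p by blast
        \<comment> \<open>the intervals tagged in the null set are estimated separately\<close>
        define q where "q = {(x, K) \<in> p. x \<in> Z}"
        have qp: "q \<subseteq> p" by (auto simp: q_def)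
        have 1: "(\<Sum>(x,K)\<in>p. F(Sup K) - F(Inf K)) = F b - F a" "(\<Sum>(x,K)\<in>p. Sup K - Inf K) = b - a"
          using additive_tagged_division_1[OF \<open>a \<le> b\<close> p, where f=F] additive_tagged_division_1[OF \<open>a \<le> b\<close> p, where f="\<lambda>x. x"]
          by auto
        have intv: "\<exists>u v. K = {u..v} \<and> u \<le> v \<and> u \<in> {a..b} \<and> v \<in> {a..b} \<and> Inf K = u \<and> Sup K = v \<and> x \<in> {u..v}" if "(x,K) \<in> p" for x K
        proof -
          obtain u v where "K = {u..v}" using tagged_division_ofD(4)[OF p \<open>(x,K) \<in> p\<close>] by auto
          then show ?thesis using tagged_division_ofD(2,3)[OF p that] by (intro exI[of _ u] exI[of _ v]) auto
        qed
        have "norm (\<Sum>(x, K)\<in>p-q. measure lborel K *\<^sub>R g x - (F (Sup K) - F (Inf K))) \<le> (\<Sum>(x,K)\<in>p-q. c * (Sup K - Inf K))"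
        proof (rule sum_norm_le, safe)
          fix x K assume xK: "(x,K) \<in> p" "(x,K) \<notin> q"
          then obtain u v where uv: "K = {u..v}" "u \<le> v" "u \<in> {a..b}" "v \<in> {a..b}" "Inf K = u" "Sup K = v" "x \<in> {u..v}"
            using intv by blast
          have xZ: "x \<notin> Z" using xK by (auto simp: q_def)
          have x: "x \<in> {a..b} - Z" using uv xZ by auto
          have "K \<subseteq> ball x (r x)" using fineD[OF fine xK(1)] xZ by (simp add: d_def)
          then have "norm (u - x) < r x" "norm (v - x) < r x"
            using uv(1,2) by (auto simp: dist_real_def subset_eq abs_minus_commute)
          then have b: "norm (F u - F x - (u - x) *\<^sub>R f x) \<le> c * (x - u)" "norm (F v - F x - (v - x) *\<^sub>R f x) \<le> c * (v - x)"
            using r(2)[OF x, of u] r(2)[OF x, of v] uv by auto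
          have "norm ((v - u) *\<^sub>R f x - (F v - F u)) = norm ((F u - F x - (u - x) *\<^sub>R f x) - (F v - F x - (v - x) *\<^sub>R f x))"
            by (auto simp: algebra_simps)
          also have "\<dots> \<le> c * (x - u) + c * (v - x)"
            by (rule order_trans[OF norm_triangle_ineq4]) (use b in linarith)
          also have "\<dots> = c * (v - u)" by (simp add: algebra_simps)
          finally show "norm (measure lborel K *\<^sub>R g x - (F (Sup K) - F (Inf K))) \<le> c * (Sup K - Inf K)"
            using uv xZ by (simp add: g_def)
        qed
        also have "\<dots> \<le> (\<Sum>(x,K)\<in>p. c * (Sup K - Inf K))"
          using finp \<open>c > 0\<close> by (intro sum_mono2) (auto dest!: intv)
        also have "\<dots> = c * (b - a)"
          using 1(2) by (simp add: sum_distrib_left[symmetric] split_def)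
        finally have A: "norm (\<Sum>(x, K)\<in>p-q. measure lborel K *\<^sub>R g x - (F (Sup K) - F (Inf K))) \<le> c * (b - a)" .
        have qpart: "q tagged_partial_division_of {a..b}"
          using p qp tagged_partial_division_subset tagged_division_of_def by blast
        note qdiv = partial_division_of_tagged_division[OF qpart]
        have "(\<Sum>K\<in>snd ` q. norm (F (Sup K) - F (Inf K))) < c * (b - a)"
        proof (rule \<delta>[OF qdiv])
          show "\<Union> (snd ` q) \<subseteq> {a..b}"
            by (auto dest!: tagged_partial_division_ofD(3)[OF qpart])
          have cl: "measure lborel K = measure lebesgue K" if "K \<in> snd ` q" for K
            using division_ofD(4)[OF qdiv that] by (auto simp: measure_completion)
          have "sum (measure lborel) (snd ` q) = measure lebesgue (\<Union> (snd ` q))"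
            using content_division[OF qdiv] cl by simp
          also have "\<dots> \<le> measure lebesgue G"
          proof (rule measure_mono_fmeasurable)
            show "\<Union> (snd ` q) \<subseteq> G"
              using fine by (auto simp: q_def d_def dest!: fineD)
            show "\<Union> (snd ` q) \<in> sets lebesgue"
              using lmeasurable_division[OF qdiv] by (rule fmeasurableD)
          qed (rule Gm)
          finally show "sum (measure lborel) (snd ` q) < \<delta>" using Gd by simp
        qed
        moreover have "(\<Sum>(x, K)\<in>q. norm (F (Sup K) - F (Inf K))) = (\<Sum>K\<in>snd ` q. norm (F (Sup K) - F (Inf K)))"
        proof -
          let ?v = "\<lambda>K. if K = {} then 0 else norm (F (Sup K) - F (Inf K))"
          have ne: "K \<noteq> {}" if "(x, K) \<in> q" for x K
            using tagged_division_ofD(2)[OF p, of x K] that qp by blast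
          have "(\<Sum>(x, K)\<in>q. norm (F (Sup K) - F (Inf K))) = (\<Sum>(x, K)\<in>q. ?v K)"
            by (intro sum.cong) (auto dest: ne)
          also have "\<dots> = (\<Sum>K\<in>snd ` q. ?v K)"
          proof (rule sum.over_tagged_division_lemma[OF tagged_partial_division_of_Union_self[OF qpart]])
            show "?v (cbox u v) = 0" if "box u v = {}" for u v :: real
              using that by (cases "u = v") auto
          qed
          also have "\<dots> = (\<Sum>K\<in>snd ` q. norm (F (Sup K) - F (Inf K)))"
            by (intro sum.cong) (auto dest: ne)
          finally show ?thesis .
        qed
        ultimately have B: "(\<Sum>(x, K)\<in>q. norm (F (Sup K) - F (Inf K))) \<le> c * (b - a)" by simp
        have "norm (\<Sum>(x, K)\<in>q. measure lborel K *\<^sub>R g x - (F (Sup K) - F (Inf K))) \<le> (\<Sum>(x, K)\<in>q. norm (F (Sup K) - F (Inf K)))"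
          by (rule sum_norm_le) (auto simp: q_def g_def norm_minus_commute)
        with B have B': "norm (\<Sum>(x, K)\<in>q. measure lborel K *\<^sub>R g x - (F (Sup K) - F (Inf K))) \<le> c * (b - a)" by simp
        have "(\<Sum>(x, K)\<in>p. measure lborel K *\<^sub>R g x) - (F b - F a) = (\<Sum>(x, K)\<in>p. measure lborel K *\<^sub>R g x - (F (Sup K) - F (Inf K)))"
          unfolding 1(1)[symmetric] by (simp add: sum_subtractf split_def)
        also have "\<dots> = (\<Sum>(x, K)\<in>p-q. measure lborel K *\<^sub>R g x - (F (Sup K) - F (Inf K))) + (\<Sum>(x, K)\<in>q. measure lborel K *\<^sub>R g x - (F (Sup K) - F (Inf K)))"
          using finp qp by (rule sum.subset_diff[rotated])
        finally have "norm ((\<Sum>(x, K)\<in>p. measure lborel K *\<^sub>R g x) - (F b - F a)) \<le> c * (b - a) + c * (b - a)"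
          using A B' by (simp only:) (rule norm_triangle_le, rule add_mono)
        also have "\<dots> = e * measure lborel {a..b}" using \<open>a \<le> b\<close> by (simp add: c_def field_simps)
        finally show ?thesis .
      qed
      ultimately have "gauge d \<and> (\<forall>p. p tagged_division_of {a..b} \<and> d fine p \<longrightarrow>
        norm ((\<Sum>(x, k)\<in>p. measure lborel k *\<^sub>R g x) - (F b - F a)) \<le> e * measure lborel {a..b})"
        by simp
      then show ?thesis by (intro exI[of _ d])
    qed
  qed
  then show ?thesis
    by (rule has_integral_spike[OF Z, rotated]) (auto simp: g_def)
qed

text \<open>
  On an interval shorter than the \<open>\<delta>\<close> that absolute continuity provides for \<open>1\<close>, the integrals of
  \<open>f\<close> over the pieces of any division have total norm at most \<open>1\<close>; this bounded variation gives
  absolute integrability there, and finitely many such intervals cover \<open>{a..b}\<close>. Without this, the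
  Lebesgue integral that defines horizontal length could be the default value \<open>0\<close>.
\<close>

theorem absolutely_continuous_absolutely_integrable:
  fixes F :: "real \<Rightarrow> 'a::euclidean_space"
  assumes "a \<le> b" and AC: "absolutely_continuous_curve {a..b} F" and Z: "negligible Z"
    and deriv: "\<And>t. t \<in> {a..b} - Z \<Longrightarrow> (F has_vector_derivative f t) (at t within {a..b})"
  shows "f absolutely_integrable_on {a..b}"
proof -
  obtain \<delta> where "\<delta> > 0" and \<delta>: "\<And>d S. \<lbrakk>d division_of S; S \<subseteq> {a..b}; sum (measure lborel) d < \<delta>\<rbrakk>
            \<Longrightarrow> (\<Sum>K\<in>d. norm (F (Sup K) - F (Inf K))) < 1"
    using absolutely_continuous_division[OF AC zero_less_one] by metis
  have sub: "(f has_integral (F v - F u)) {u..v}" if "u \<le> v" "{u..v} \<subseteq> {a..b}" for u v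
  proof (rule absolutely_continuous_has_integral[OF \<open>u \<le> v\<close> _ Z])
    show "absolutely_continuous_curve {u..v} F"
      using AC that(2) by (rule absolutely_continuous_curve_subset)
    show "(F has_vector_derivative f t) (at t within {u..v})" if "t \<in> {u..v} - Z" for t
      using deriv[of t] \<open>{u..v} \<subseteq> {a..b}\<close> that by (meson DiffE DiffI has_vector_derivative_within_subset subsetD)
  qed
  have loc: "f absolutely_integrable_on {u..v}" if "u \<le> v" "{u..v} \<subseteq> {a..b}" "v - u < \<delta>" for u v
  proof -
    have "f absolutely_integrable_on cbox u v"
    proof (rule bounded_variation_absolutely_integrable_interval[where B=1])
      show "f integrable_on cbox u v" using sub[OF that(1,2)] by auto
      fix d assume d: "d division_of cbox u v"
      have "(\<Sum>K\<in>d. norm (integral K f)) = (\<Sum>K\<in>d. norm (F (Sup K) - F (Inf K)))"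
      proof (rule sum.cong[OF refl])
        fix K assume K: "K \<in> d"
        obtain x y where xy: "K = {x..y}" "x \<le> y"
          using division_ofD(3,4)[OF d K] by (metis atLeastatMost_empty_iff box_real(2))
        have "K \<subseteq> {a..b}" using division_ofD(2)[OF d K] that(2) by auto
        with xy have "integral K f = F y - F x" using sub by blast
        then show "norm (integral K f) = norm (F (Sup K) - F (Inf K))" using xy by simp
      qed
      moreover have "\<dots> < 1"
        using additive_content_division[OF d] that by (intro \<delta>[OF d]) auto
      ultimately show "(\<Sum>K\<in>d. norm (integral K f)) \<le> 1" by simp
    qed
    then show ?thesis by simp
  qed
  have "f absolutely_integrable_on {a..min b (a + real n * (\<delta>/2))}" for n
  proof (induction n)
    case 0
    show ?case using loc[of a a] \<open>a \<le> b\<close> \<open>\<delta> > 0\<close> by simp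
  next
    case (Suc n)
    let ?u = "min b (a + real n * (\<delta>/2))" and ?v = "min b (a + real (Suc n) * (\<delta>/2))"
    have uv: "a \<le> ?u" "?u \<le> ?v" "?v \<le> b" "?v - ?u < \<delta>"
      using \<open>a \<le> b\<close> \<open>\<delta> > 0\<close> by (auto simp: min_def field_simps)
    have "f absolutely_integrable_on {?u..?v}"
      using uv by (intro loc) auto
    then have "f absolutely_integrable_on {a..?u} \<union> {?u..?v}"
      using Suc.IH by (intro absolutely_integrable_Un)
    also have "{a..?u} \<union> {?u..?v} = {a..?v}"
      using uv by (intro ivl_disj_un_two_touch)
    finally show ?case .
  qed
  moreover obtain n where n: "real n * (\<delta>/2) > b - a"
    using reals_Archimedean3[of "\<delta>/2"] \<open>\<delta> > 0\<close> half_gt_zero by blast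
  moreover have "min b (a + real n * (\<delta>/2)) = b"
    using n by simp
  ultimately show ?thesis by metis
qed

lemma absolutely_continuous_curve_lipschitz:
  fixes F :: "real \<Rightarrow> 'a::metric_space"
  assumes lip: "\<And>s t. s \<in> I \<Longrightarrow> t \<in> I \<Longrightarrow> dist (F s) (F t) \<le> C * \<bar>s - t\<bar>"
  shows "absolutely_continuous_curve I F"
  unfolding absolutely_continuous_curve_iff
proof (intro allI impI)
  fix e :: real assume "e > 0"
  define B where "B = \<bar>C\<bar> + 1"
  have "B > 0" "C \<le> B" by (auto simp: B_def)
  show "\<exists>\<delta>>0. \<forall>D. finite D \<longrightarrow> (\<forall>(s, t)\<in>D. s \<in> I \<and> t \<in> I \<and> s < t) \<longrightarrow>
      pairwise (\<lambda>(s, t) (s', t'). t \<le> s' \<or> t' \<le> s) D \<longrightarrow>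
      (\<Sum>(s, t)\<in>D. t - s) < \<delta> \<longrightarrow> (\<Sum>(s, t)\<in>D. dist (F s) (F t)) < e"
  proof (intro exI[of _ "e/B"] conjI allI impI)
    fix D assume D: "\<forall>(s, t)\<in>D. s \<in> I \<and> t \<in> I \<and> s < t" "(\<Sum>(s, t)\<in>D. t - s) < e / B"
    have "(\<Sum>(s, t)\<in>D. dist (F s) (F t)) \<le> (\<Sum>(s, t)\<in>D. B * (t - s))"
    proof (rule sum_mono, clarify)
      fix s t assume "(s, t) \<in> D"
      then have st: "s \<in> I" "t \<in> I" "s < t" using D(1) by auto
      have "dist (F s) (F t) \<le> C * (t - s)" using lip[OF st(1,2)] st(3) by simp
      also have "\<dots> \<le> B * (t - s)" using \<open>C \<le> B\<close> st(3) by (intro mult_right_mono) auto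
      finally show "dist (F s) (F t) \<le> B * (t - s)" .
    qed
    also have "\<dots> = B * (\<Sum>(s, t)\<in>D. t - s)" by (simp add: sum_distrib_left split_def)
    also have "\<dots> < B * (e / B)" using D(2) \<open>B > 0\<close> by (rule mult_strict_left_mono)
    also have "\<dots> = e" using \<open>B > 0\<close> by simp
    finally show "(\<Sum>(s, t)\<in>D. dist (F s) (F t)) < e" .
  qed (use \<open>e > 0\<close> \<open>B > 0\<close> in simp)
qed

lemma absolutely_continuous_curve_bounded_linear_add:
  fixes F :: "real \<Rightarrow> 'a::real_normed_vector" and G :: "real \<Rightarrow> 'b::real_normed_vector"
  assumes F: "absolutely_continuous_curve I F" and "bounded_linear l"
    and G: "absolutely_continuous_curve I G"
  shows "absolutely_continuous_curve I (\<lambda>t. l (F t) + G t)"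
  unfolding absolutely_continuous_curve_iff
proof (intro allI impI)
  fix e :: real assume "e > 0"
  interpret bounded_linear l by fact
  obtain B where "B > 0" and B: "\<And>x. norm (l x) \<le> norm x * B"
    using pos_bounded by blast
  have "e / (2*B) > 0" "e / 2 > 0" using \<open>e > 0\<close> \<open>B > 0\<close> by auto
  obtain \<delta>1 where "\<delta>1 > 0" and \<delta>1: "\<forall>D. finite D \<longrightarrow> (\<forall>(s, t)\<in>D. s \<in> I \<and> t \<in> I \<and> s < t) \<longrightarrow>
      pairwise (\<lambda>(s, t) (s', t'). t \<le> s' \<or> t' \<le> s) D \<longrightarrow>
      (\<Sum>(s, t)\<in>D. t - s) < \<delta>1 \<longrightarrow> (\<Sum>(s, t)\<in>D. dist (F s) (F t)) < e / (2*B)"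
    using F \<open>e / (2*B) > 0\<close> unfolding absolutely_continuous_curve_iff by blast
  obtain \<delta>2 where "\<delta>2 > 0" and \<delta>2: "\<forall>D. finite D \<longrightarrow> (\<forall>(s, t)\<in>D. s \<in> I \<and> t \<in> I \<and> s < t) \<longrightarrow>
      pairwise (\<lambda>(s, t) (s', t'). t \<le> s' \<or> t' \<le> s) D \<longrightarrow>
      (\<Sum>(s, t)\<in>D. t - s) < \<delta>2 \<longrightarrow> (\<Sum>(s, t)\<in>D. dist (G s) (G t)) < e / 2"
    using G \<open>e / 2 > 0\<close> unfolding absolutely_continuous_curve_iff by blast
  show "\<exists>\<delta>>0. \<forall>D. finite D \<longrightarrow> (\<forall>(s, t)\<in>D. s \<in> I \<and> t \<in> I \<and> s < t) \<longrightarrow>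
      pairwise (\<lambda>(s, t) (s', t'). t \<le> s' \<or> t' \<le> s) D \<longrightarrow>
      (\<Sum>(s, t)\<in>D. t - s) < \<delta> \<longrightarrow> (\<Sum>(s, t)\<in>D. dist (l (F s) + G s) (l (F t) + G t)) < e"
  proof (intro exI[of _ "min \<delta>1 \<delta>2"] conjI allI impI)
    fix D assume D: "finite D" "\<forall>(s, t)\<in>D. s \<in> I \<and> t \<in> I \<and> s < t" 
      "pairwise (\<lambda>(s, t) (s', t'). t \<le> s' \<or> t' \<le> s) D" "(\<Sum>(s, t)\<in>D. t - s) < min \<delta>1 \<delta>2"
    have "(\<Sum>(s, t)\<in>D. dist (l (F s) + G s) (l (F t) + G t)) \<le> (\<Sum>(s, t)\<in>D. B * dist (F s) (F t) + dist (G s) (G t))"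
    proof (rule sum_mono, clarify)
      fix s t
      have "dist (l (F s) + G s) (l (F t) + G t) \<le> dist (l (F s)) (l (F t)) + dist (G s) (G t)"
        by (rule dist_triangle_add)
      also have "dist (l (F s)) (l (F t)) \<le> B * dist (F s) (F t)"
        using B[of "F s - F t"] by (simp add: dist_norm diff mult.commute)
      finally show "dist (l (F s) + G s) (l (F t) + G t) \<le> B * dist (F s) (F t) + dist (G s) (G t)" by simp
    qed
    also have "\<dots> = B * (\<Sum>(s, t)\<in>D. dist (F s) (F t)) + (\<Sum>(s, t)\<in>D. dist (G s) (G t))"
      by (simp add: sum.distrib sum_distrib_left split_def)
    also have "\<dots> < B * (e / (2*B)) + e / 2"
      using \<delta>1[rule_format, OF D(1) _ D(3)] \<delta>2[rule_format, OF D(1) _ D(3)] D(2,4) \<open>B > 0\<close>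
      by (intro add_strict_mono mult_strict_left_mono) auto
    also have "\<dots> = e" using \<open>B > 0\<close> by simp
    finally show "(\<Sum>(s, t)\<in>D. dist (l (F s) + G s) (l (F t) + G t)) < e" .
  qed (use \<open>\<delta>1 > 0\<close> \<open>\<delta>2 > 0\<close> in simp)
qed

section \<open>The horizontal projection and the vertical gap\<close>

definition hproj :: "'n::finite heis \<Rightarrow> (real, 'n) vec \<times> (real, 'n) vec" where
  "hproj p = (fst p, fst (snd p))"

text \<open>
  The symplectic form of the group law: \<open>hmult p q\<close> has last coordinate equal to the sum of the last
  coordinates of \<open>p\<close> and \<open>q\<close> minus \<open>2 * symplectic (hproj p) (hproj q)\<close>.
\<close>

definition symplectic :: "(real, 'n::finite) vec \<times> (real, 'n) vec \<Rightarrow> (real, 'n) vec \<times> (real, 'n) vec \<Rightarrow> real" where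
  "symplectic h k = fst h \<bullet> snd k - snd h \<bullet> fst k"

text \<open>
  The last coordinate of the group element \<open>p\<inverse>q\<close>. Together with \<open>hproj q - hproj p\<close> it gives
  left-invariant coordinates of \<open>q\<close> seen from \<open>p\<close>.
\<close>

definition vgap :: "'n::finite heis \<Rightarrow> 'n heis \<Rightarrow> real" where
  "vgap p q = snd (snd q) - snd (snd p) + 2 * symplectic (hproj p) (hproj q)"

lemma hproj_simps [simp]:
  "hproj (a, b, c) = (a, b)" "hproj (p + q) = hproj p + hproj q" "hproj (p - q) = hproj p - hproj q"
  "hproj (r *\<^sub>R p) = r *\<^sub>R hproj p" 
  by (auto simp: hproj_def)

lemma bounded_linear_hproj: "bounded_linear hproj"
  unfolding hproj_def
  by (intro bounded_linear_Pair bounded_linear_fst bounded_linear_compose[OF bounded_linear_fst bounded_linear_snd])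

lemma symplectic_le: "\<bar>symplectic h k\<bar> \<le> norm h * norm k"
proof -
  have "symplectic h k = h \<bullet> (snd k, - fst k)"
    by (simp add: symplectic_def inner_prod_def)
  moreover have "norm (snd k, - fst k) = norm k"
    by (cases k) (simp add: norm_Pair add.commute)
  ultimately show ?thesis
    using Cauchy_Schwarz_ineq2[of h "(snd k, - fst k)"] by simp
qed

lemma bounded_bilinear_symplectic: "bounded_bilinear symplectic"
proof
  show "\<exists>K. \<forall>a b. norm (symplectic a b) \<le> norm a * norm b * K"
    by (rule exI[of _ 1]) (use symplectic_le in auto)
qed (auto simp: symplectic_def inner_add_left inner_add_right algebra_simps)

interpretation symplectic: bounded_bilinear symplectic by (rule bounded_bilinear_symplectic)

lemma symplectic_self [simp]: "symplectic h h = 0"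
  by (simp add: symplectic_def inner_commute)

lemma symplectic_swap: "symplectic k h = - symplectic h k"
  by (simp add: symplectic_def inner_commute)

lemma hfield_eq: "hfield h p = (fst h, snd h, 2 * symplectic h (hproj p))"
  using hfield_Pair[of "fst h" "snd h" "fst p" "fst (snd p)" "snd (snd p)"]
  by (simp add: symplectic_def hproj_def)

lemma hproj_hfield [simp]: "hproj (hfield h p) = h"
  by (simp add: hfield_eq)

lemma heis_eqI: "hproj p = hproj q \<Longrightarrow> snd (snd p) = snd (snd q) \<Longrightarrow> p = q"
  by (cases p; cases q) auto

section \<open>The Carnot-Caratheodory distance in coordinates\<close>

lemma hlengths_nonneg: "l \<in> hlengths x y \<Longrightarrow> 0 \<le> l"
  unfolding hlengths_def by (auto intro!: integral_nonneg_AE simp: set_lebesgue_integral_def)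

lemma bdd_below_hlengths: "bdd_below (hlengths x y)"
  using hlengths_nonneg by (rule bdd_belowI)

text \<open>
  Along a horizontal curve the projection has derivative \<open>h\<close>, and the vertical gap from the starting
  point has derivative \<open>2 * symplectic (h t) (hproj (\<gamma> t) - hproj (\<gamma> a))\<close>. The first is integrated
  directly; in the second the displacement is at most the length \<open>l\<close>, so the gap is at most
  quadratic in \<open>l\<close>.
\<close>
lemma horizontal_length_bounds:
  assumes "a \<le> b" and hor: "horizontal_with {a..b} \<gamma> h"
  defines "l \<equiv> LINT t:{a..b}|lebesgue. norm (h t)"
  shows "norm (hproj (\<gamma> b) - hproj (\<gamma> a)) \<le> l" and "\<bar>vgap (\<gamma> a) (\<gamma> b)\<bar> \<le> 2 * l\<^sup>2"
proof -
  define G where "G t = hfield (h t) (\<gamma> t)" for t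
  define Z where "Z = {t. \<not> (t \<in> {a..b} \<longrightarrow> (\<gamma> has_vector_derivative G t) (at t within {a..b}))}"
  have AC: "absolutely_continuous_curve {a..b} \<gamma>" using hor by (simp add: horizontal_with_def)
  have "AE t in lebesgue. t \<in> {a..b} \<longrightarrow> (\<gamma> has_vector_derivative G t) (at t within {a..b})"
    using hor by (simp add: horizontal_with_def G_def)
  then have Z: "negligible Z"
    unfolding Z_def by (simp add: negligible_iff_null_sets completion.AE_iff_null_sets)
  have deriv: "(\<gamma> has_vector_derivative G t) (at t within {a..b})" if "t \<in> {a..b} - Z" for t
    using that by (auto simp: Z_def)
  have Gabs: "G absolutely_integrable_on {a..b}"
    by (rule absolutely_continuous_absolutely_integrable[OF \<open>a \<le> b\<close> AC Z deriv])
  have hG: "h = hproj \<circ> G" by (auto simp: G_def)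
  have habs: "h absolutely_integrable_on {a..b}"
    unfolding hG by (rule absolutely_integrable_linear[OF Gabs bounded_linear_hproj])
  have nint: "(\<lambda>t. norm (h t)) absolutely_integrable_on {a..b}"
    using absolutely_integrable_norm[OF habs] by (simp add: o_def)
  have l: "l = integral {a..b} (\<lambda>t. norm (h t))"
    unfolding l_def using nint by (rule set_lebesgue_integral_eq_integral)
  have nint': "(\<lambda>t. norm (h t)) integrable_on {a..b}"
    using nint by (rule set_lebesgue_integral_eq_integral)
  have sub: "(G has_integral (\<gamma> t - \<gamma> a)) {a..t}" if "t \<in> {a..b}" for t
  proof (rule absolutely_continuous_has_integral[OF _ _ Z])
    show "a \<le> t" using that by simp
    show "absolutely_continuous_curve {a..t} \<gamma>"
      using AC by (rule absolutely_continuous_curve_subset) (use that in auto)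
    show "(\<gamma> has_vector_derivative G s) (at s within {a..t})" if "s \<in> {a..t} - Z" for s
      using deriv[of s] that \<open>t \<in> {a..b}\<close> by (auto intro: has_vector_derivative_within_subset)
  qed
  have P: "norm (hproj (\<gamma> t) - hproj (\<gamma> a)) \<le> l" if t: "t \<in> {a..b}" for t
  proof -
    have hint: "(h has_integral (hproj (\<gamma> t) - hproj (\<gamma> a))) {a..t}"
      using has_integral_linear[OF sub[OF t] bounded_linear_hproj] unfolding hG by simp
    have int: "(\<lambda>t. norm (h t)) integrable_on {a..t}"
      using nint' by (rule integrable_subinterval_real) (use t in auto)
    have "norm (hproj (\<gamma> t) - hproj (\<gamma> a)) = norm (integral {a..t} h)"
      using hint by (simp add: integral_unique)
    also have "\<dots> \<le> integral {a..t} (\<lambda>t. norm (h t))"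
      using hint int by (intro integral_norm_bound_integral) auto
    also have "\<dots> \<le> l"
      unfolding l using t by (intro integral_subset_le int nint') auto
    finally show ?thesis .
  qed
  show "norm (hproj (\<gamma> b) - hproj (\<gamma> a)) \<le> l" using P[of b] \<open>a \<le> b\<close> by simp
  \<comment> \<open>the vertical gap from the fixed starting point is linear in the end point, up to a constant\<close>
  define L where "L p = snd (snd p) + 2 * symplectic (hproj (\<gamma> a)) (hproj p)" for p
  have L: "bounded_linear L"
    unfolding L_def
    by (intro bounded_linear_add bounded_linear_compose[OF bounded_linear_snd bounded_linear_snd]
      bounded_linear_const_mult bounded_linear_compose[OF symplectic.bounded_linear_right bounded_linear_hproj])
  have "((L \<circ> G) has_integral L (\<gamma> b - \<gamma> a)) {a..b}"
    using has_integral_linear[OF sub[of b] L] \<open>a \<le> b\<close> by simp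
  moreover have "L (\<gamma> b - \<gamma> a) = vgap (\<gamma> a) (\<gamma> b)"
    by (simp add: L_def vgap_def symplectic.diff_right)
  moreover have LG: "L (G t) = 2 * symplectic (h t) (hproj (\<gamma> t) - hproj (\<gamma> a))" for t
    using symplectic_swap[of "h t" "hproj (\<gamma> a)"] by (simp add: L_def G_def hfield_eq symplectic.diff_right)
  ultimately have v: "((L \<circ> G) has_integral vgap (\<gamma> a) (\<gamma> b)) {a..b}" by simp
  have "norm (vgap (\<gamma> a) (\<gamma> b)) = norm (integral {a..b} (L \<circ> G))"
    using v by (simp add: integral_unique)
  also have "\<dots> \<le> integral {a..b} (\<lambda>t. 2 * l * norm (h t))"
  proof (rule integral_norm_bound_integral)
    show "(L \<circ> G) integrable_on {a..b}" using v by blast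
    show "(\<lambda>t. 2 * l * norm (h t)) integrable_on {a..b}"
      using nint' by (rule integrable_on_mult_right)
    show "norm ((L \<circ> G) t) \<le> 2 * l * norm (h t)" if "t \<in> {a..b}" for t
      using symplectic_le[of "h t" "hproj (\<gamma> t) - hproj (\<gamma> a)"] mult_left_mono[OF P[OF that], of "norm (h t)"]
      by (simp add: LG abs_mult mult.commute)
  qed
  also have "\<dots> = 2 * l * l" by (simp add: l)
  finally show "\<bar>vgap (\<gamma> a) (\<gamma> b)\<bar> \<le> 2 * l\<^sup>2" by (simp add: power2_eq_square)
qed

lemma ccdist_le_of_smooth_curve:
  assumes \<gamma>: "\<And>t. t \<in> {0..1} \<Longrightarrow> (\<gamma> has_vector_derivative hfield (h t) (\<gamma> t)) (at t within {0..1})"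
    and h: "continuous_on {0..1} h" and M: "\<And>t. t \<in> {0..1} \<Longrightarrow> norm (h t) \<le> M"
  shows "hlengths (\<gamma> 0) (\<gamma> 1) \<noteq> {}" "ccdist (\<gamma> 0) (\<gamma> 1) \<le> M"
proof -
  have c\<gamma>: "continuous_on {0..1} \<gamma>"
    using \<gamma> by (rule continuous_on_vector_derivative)
  have "continuous_on {0..1} (\<lambda>t. hfield (h t) (\<gamma> t))"
    unfolding hfield_eq hproj_def
    by (intro continuous_intros symplectic.continuous_on h c\<gamma>)
  then have "compact ((\<lambda>t. hfield (h t) (\<gamma> t)) ` {0..1})"
    by (rule compact_continuous_image) simp
  then have "bounded ((\<lambda>t. hfield (h t) (\<gamma> t)) ` {0..1})"
    by (rule compact_imp_bounded)
  then obtain B where B': "\<forall>x\<in>(\<lambda>t. hfield (h t) (\<gamma> t)) ` {0..1}. norm x \<le> B"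
    unfolding bounded_iff by (rule exE)
  have B: "norm (hfield (h t) (\<gamma> t)) \<le> B" if "t \<in> {0..1}" for t
    using B' that by simp
  have lip: "dist (\<gamma> s) (\<gamma> t) \<le> B * \<bar>s - t\<bar>" if "s \<in> {0..1}" "t \<in> {0..1}" for s t
  proof -
    have "norm (\<gamma> s - \<gamma> t) \<le> B * norm (s - t)"
    proof (rule differentiable_bound[of "{0..1}" \<gamma> "\<lambda>t x. x *\<^sub>R hfield (h t) (\<gamma> t)"])
      show "(\<gamma> has_derivative (\<lambda>x. x *\<^sub>R hfield (h t) (\<gamma> t))) (at t within {0..1})" if "t \<in> {0..1}" for t
        using \<gamma>[OF that] by (simp add: has_vector_derivative_def)
      show "onorm (\<lambda>x. x *\<^sub>R hfield (h t) (\<gamma> t)) \<le> B" if "t \<in> {0..1}" for t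
        using B[OF that] by (intro onorm_le) (simp add: mult.commute[of B] mult_left_mono)
    qed (use that in auto)
    then show ?thesis by (simp add: dist_norm)
  qed
  have hor: "horizontal_with {0..1} \<gamma> h"
    unfolding horizontal_with_def
    using \<gamma> absolutely_continuous_curve_lipschitz[OF lip, of "{0..1}"] by (simp add: is_interval_cc)
  have nh: "continuous_on {0..1} (\<lambda>t. norm (h t))" using h by (intro continuous_intros)
  have "(LINT t:{0..1}|lebesgue. norm (h t)) = integral {0..1} (\<lambda>t. norm (h t))"
    using nh by (intro set_lebesgue_integral_eq_integral absolutely_integrable_continuous_real)
  also have "\<dots> \<le> M * (1 - 0)"
    using integral_bound[of 0 1 "\<lambda>t. norm (h t)" M] nh M by auto
  finally have le: "(LINT t:{0..1}|lebesgue. norm (h t)) \<le> M" by simp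
  have mem: "(LINT t:{0..1}|lebesgue. norm (h t)) \<in> hlengths (\<gamma> 0) (\<gamma> 1)"
    unfolding hlengths_def using hor by (intro CollectI exI conjI refl) auto
  then show "hlengths (\<gamma> 0) (\<gamma> 1) \<noteq> {}" by blast
  show "ccdist (\<gamma> 0) (\<gamma> 1) \<le> M"
    unfolding ccdist_def using cInf_lower[OF mem bdd_below_hlengths] le by linarith
qed

text \<open>
  An explicit polynomial curve from \<open>p\<close> to \<open>q\<close>. Its projection runs along the segment from \<open>hproj p\<close>
  to \<open>hproj q\<close> and adds the closed loop \<open>\<alpha> A + \<beta> B\<close> in one coordinate plane. The polynomials
  \<open>\<alpha>\<close> and \<open>\<beta>\<close> vanish at \<open>0\<close> and \<open>1\<close> and have integral \<open>0\<close>, so that the segment and the loop do not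
  interact: the loop raises the end point by twice the quantity
  \<open>symplectic A B * (\<integral> \<alpha>' \<beta> - \<beta>' \<alpha>) = symplectic A B / 35\<close>. Scaling the loop by the square root of
  the vertical gap produces any height, with the sign carried by \<open>B\<close>. On \<open>{0..1}\<close> the crude bounds
  \<open>13\<close> and \<open>63\<close> for \<open>\<alpha>'\<close> and \<open>\<beta>'\<close> and the factor \<open>sqrt (35 / 2) \<le> 5\<close> account for
  \<open>380 = 5 * (13 + 63)\<close>.
\<close>

theorem horizontal_connection:
  fixes p q :: "'n::finite heis"
  shows "hlengths p q \<noteq> {} \<and> ccdist p q \<le> norm (hproj q - hproj p) + 380 * sqrt \<bar>vgap p q\<bar>"
proof -
  define w where "w = hproj q - hproj p"
  define v where "v = vgap p q"
  define r where "r = sqrt (35 * \<bar>v\<bar> / 2)"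
  have r0: "r \<ge> 0" by (simp add: r_def)
  have rr: "r * r = 35 * \<bar>v\<bar> / 2" by (simp add: r_def)
  obtain i :: 'n where True by simp
  define A :: "(real, 'n) vec \<times> (real, 'n) vec" where "A = (axis i r, 0)"
  define B :: "(real, 'n) vec \<times> (real, 'n) vec" where "B = (0, axis i (sgn v * r))"
  have nA: "norm A \<le> r" and nB: "norm B \<le> r"
  proof -
    have "norm (axis i x :: (real, 'n) vec) = \<bar>x\<bar>" for x
      by (simp add: norm_eq_sqrt_inner inner_axis_axis)
    then show "norm A \<le> r" "norm B \<le> r"
      using r0 by (auto simp: A_def B_def norm_Pair abs_mult sgn_real_def)
  qed
  have AB: "symplectic A B = 35 * v / 2"
    using rr by (simp add: A_def B_def symplectic_def inner_axis_axis sgn_real_def)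
  \<comment> \<open>primes are derivatives, \<open>\<alpha>i\<close> and \<open>\<beta>i\<close> antiderivatives, and \<open>W\<close> is the antiderivative of \<open>\<alpha>' \<beta> - \<beta>' \<alpha>\<close>\<close>
  define \<alpha> \<alpha>' \<alpha>i \<beta> \<beta>' \<beta>i W :: "real \<Rightarrow> real" where
    "\<alpha> t = t - 3 * t^2 + 2 * t^3" and "\<alpha>' t = 1 - 6 * t + 6 * t^2"
    and "\<alpha>i t = t^2 / 2 - t^3 + t^4 / 2"
    and "\<beta> t = t - 6 * t^2 + 10 * t^3 - 5 * t^4" and "\<beta>' t = 1 - 12 * t + 30 * t^2 - 20 * t^3"
    and "\<beta>i t = t^2 / 2 - 2 * t^3 + 5 * t^4 / 2 - t^5"
    and "W t = t^3 - 4 * t^4 + 33 * t^5 / 5 - 5 * t^6 + 10 * t^7 / 7" for t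
  define h where "h t = w + \<alpha>' t *\<^sub>R A + \<beta>' t *\<^sub>R B" for t
  define P where "P t = hproj p + t *\<^sub>R w + \<alpha> t *\<^sub>R A + \<beta> t *\<^sub>R B" for t
  \<comment> \<open>the height that makes the curve horizontal: its derivative is \<open>2 * symplectic (h t) (P t)\<close>\<close>
  define c where "c t = snd (snd p) + 2 * (t * symplectic w (hproj p) + \<alpha> t * symplectic A (hproj p) + \<beta> t * symplectic B (hproj p)
     + symplectic w A * (2 * \<alpha>i t - t * \<alpha> t) + symplectic w B * (2 * \<beta>i t - t * \<beta> t) + symplectic A B * W t)" for t
  define \<gamma> :: "real \<Rightarrow> 'n heis" where "\<gamma> t = (fst (P t), snd (P t), c t)" for t
  have d\<alpha>: "(\<alpha> has_real_derivative \<alpha>' t) (at t)" for t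
    unfolding \<alpha>_def \<alpha>'_def by (auto intro!: derivative_eq_intros)
  have d\<beta>: "(\<beta> has_real_derivative \<beta>' t) (at t)" for t
    unfolding \<beta>_def \<beta>'_def by (auto intro!: derivative_eq_intros)
  have d\<alpha>i: "(\<alpha>i has_real_derivative \<alpha> t) (at t)" for t
    unfolding \<alpha>_def \<alpha>i_def by (auto intro!: derivative_eq_intros)
  have d\<beta>i: "(\<beta>i has_real_derivative \<beta> t) (at t)" for t
    unfolding \<beta>_def \<beta>i_def by (auto intro!: derivative_eq_intros)
  have dW: "(W has_real_derivative (\<alpha>' t * \<beta> t - \<beta>' t * \<alpha> t)) (at t)" for t
  proof -
    have "(W has_real_derivative (3 * t^2 - 16 * t^3 + 33 * t^4 - 30 * t^5 + 10 * t^6)) (at t)"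
      unfolding W_def by (auto intro!: derivative_eq_intros)
    moreover have "3 * t^2 - 16 * t^3 + 33 * t^4 - 30 * t^5 + 10 * t^6 = \<alpha>' t * \<beta> t - \<beta>' t * \<alpha> t"
      unfolding \<alpha>_def \<alpha>'_def \<beta>_def \<beta>'_def by algebra
    ultimately show ?thesis by simp
  qed
  have dP: "(P has_vector_derivative h t) (at t)" for t
    unfolding P_def h_def
    using d\<alpha> d\<beta> by (auto intro!: derivative_eq_intros simp: has_real_derivative_iff_has_vector_derivative)
  have hP: "symplectic (h t) (P t) = symplectic w (hproj p) + \<alpha>' t * symplectic A (hproj p) + \<beta>' t * symplectic B (hproj p)
     + symplectic w A * (\<alpha> t - t * \<alpha>' t) + symplectic w B * (\<beta> t - t * \<beta>' t) + symplectic A B * (\<alpha>' t * \<beta> t - \<beta>' t * \<alpha> t)" for t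
    unfolding h_def P_def symplectic_swap[of A w] symplectic_swap[of B w]
    by (simp add: symplectic.add_left symplectic.add_right symplectic.scaleR_left symplectic.scaleR_right
      symplectic_swap[of A w] symplectic_swap[of B w] symplectic_swap[of B A] algebra_simps)
  have dc: "(c has_vector_derivative 2 * symplectic (h t) (P t)) (at t)" for t
    unfolding hP c_def has_real_derivative_iff_has_vector_derivative[symmetric]
    by (rule derivative_eq_intros d\<alpha> d\<beta> d\<alpha>i d\<beta>i dW refl | simp add: algebra_simps)+
  have hP\<gamma>: "hproj (\<gamma> t) = P t" for t by (simp add: \<gamma>_def)
  have d\<gamma>: "(\<gamma> has_vector_derivative hfield (h t) (\<gamma> t)) (at t)" for t
  proof -
    have "((\<lambda>t. fst (P t)) has_vector_derivative fst (h t)) (at t)"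
      "((\<lambda>t. snd (P t)) has_vector_derivative snd (h t)) (at t)"
      using bounded_linear.has_vector_derivative[OF bounded_linear_fst dP]
        bounded_linear.has_vector_derivative[OF bounded_linear_snd dP] by auto
    then show ?thesis
      unfolding \<gamma>_def hfield_eq using dc[of t] by (auto intro!: has_vector_derivative_Pair)
  qed
  have \<gamma>0: "\<gamma> 0 = p"
    by (rule heis_eqI) (simp_all add: \<gamma>_def P_def c_def \<alpha>_def \<beta>_def \<alpha>i_def \<beta>i_def W_def)
  have \<gamma>1: "\<gamma> 1 = q"
  proof (rule heis_eqI)
    show "hproj (\<gamma> 1) = hproj q" by (simp add: hP\<gamma> P_def \<alpha>_def \<beta>_def w_def)
    have "snd (snd (\<gamma> 1)) = snd (snd p) + 2 * (symplectic w (hproj p) + v / 2)"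
      by (simp add: \<gamma>_def c_def \<alpha>_def \<beta>_def \<alpha>i_def \<beta>i_def W_def AB)
    also have "symplectic w (hproj p) = - symplectic (hproj p) (hproj q)"
      by (simp add: w_def symplectic.diff_left symplectic_swap[of "hproj q"])
    finally show "snd (snd (\<gamma> 1)) = snd (snd q)" by (simp add: v_def vgap_def field_simps)
  qed
  have bnd: "norm (h t) \<le> norm w + 76 * r" if t: "t \<in> {0..1}" for t
  proof -
    have t': "0 \<le> t" "t \<le> 1" "0 \<le> t^2" "t^2 \<le> 1" "0 \<le> t^3" "t^3 \<le> 1"
      using t by (auto intro: power_le_one)
    have "\<bar>\<alpha>' t\<bar> \<le> 13" "\<bar>\<beta>' t\<bar> \<le> 63"
      unfolding \<alpha>'_def \<beta>'_def using t' by linarith+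
    then have "\<bar>\<alpha>' t\<bar> * norm A \<le> 13 * r" "\<bar>\<beta>' t\<bar> * norm B \<le> 63 * r"
      using nA nB by (auto intro!: mult_mono)
    moreover have "norm (h t) \<le> norm w + \<bar>\<alpha>' t\<bar> * norm A + \<bar>\<beta>' t\<bar> * norm B"
      unfolding h_def using norm_triangle_ineq[of "w + \<alpha>' t *\<^sub>R A" "\<beta>' t *\<^sub>R B"] norm_triangle_ineq[of w "\<alpha>' t *\<^sub>R A"]
      by simp
    ultimately show ?thesis by linarith
  qed
  have "hlengths (\<gamma> 0) (\<gamma> 1) \<noteq> {}" "ccdist (\<gamma> 0) (\<gamma> 1) \<le> norm w + 76 * r"
  proof -
    have ch: "continuous_on {0..1} h"
      unfolding h_def \<alpha>'_def \<beta>'_def by (intro continuous_intros)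
    show "hlengths (\<gamma> 0) (\<gamma> 1) \<noteq> {}" "ccdist (\<gamma> 0) (\<gamma> 1) \<le> norm w + 76 * r"
      using ccdist_le_of_smooth_curve[OF has_vector_derivative_at_within[OF d\<gamma>] ch bnd] by auto
  qed
  moreover have "r \<le> 5 * sqrt \<bar>v\<bar>"
  proof -
    have "r \<le> sqrt (25 * \<bar>v\<bar>)" unfolding r_def by (rule real_sqrt_le_mono) simp
    then show ?thesis by (simp add: real_sqrt_mult)
  qed
  ultimately show ?thesis unfolding \<gamma>0 \<gamma>1 w_def v_def by auto
qed

lemma ccdist_lower:
  shows "norm (hproj q - hproj p) \<le> ccdist p q" and "sqrt (\<bar>vgap p q\<bar> / 2) \<le> ccdist p q"
proof -
  have ne: "hlengths p q \<noteq> {}" using horizontal_connection by blast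
  have "norm (hproj q - hproj p) \<le> l \<and> sqrt (\<bar>vgap p q\<bar> / 2) \<le> l" if l: "l \<in> hlengths p q" for l
  proof -
    from l obtain a b \<gamma> h where "a \<le> b" "horizontal_with {a..b} \<gamma> h" and
      eq: "\<gamma> a = p" "\<gamma> b = q" "l = (LINT t:{a..b}|lebesgue. norm (h t))"
      unfolding hlengths_def by blast
    note * = horizontal_length_bounds[OF this(1,2), unfolded eq(1,2)]
    have "sqrt (\<bar>vgap p q\<bar> / 2) \<le> sqrt (l\<^sup>2)"
      using *(2) by (intro real_sqrt_le_mono) (simp add: eq(3))
    then show ?thesis using * hlengths_nonneg[OF l] by (simp add: eq(3))
  qed
  then show "norm (hproj q - hproj p) \<le> ccdist p q" "sqrt (\<bar>vgap p q\<bar> / 2) \<le> ccdist p q"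
    unfolding ccdist_def using ne by (auto intro!: cInf_greatest)
qed

lemma ccdist_nonneg: "0 \<le> ccdist p q"
  using ccdist_lower(1)[of q p] norm_ge_zero order_trans by blast

lemma vgap_le_ccdist: "\<bar>vgap p q\<bar> \<le> 2 * (ccdist p q)\<^sup>2"
  using sqrt_le_D[OF ccdist_lower(2)[of p q]] by simp

lemma ccdist_le_coordinates: "ccdist p q \<le> norm (hproj q - hproj p) + 380 * sqrt \<bar>vgap p q\<bar>"
  using horizontal_connection by blast

section \<open>Horizontal derivatives are derivatives along straight lines\<close>

lemma hproj_flow: "hproj (x + s *\<^sub>R hfield u x) = hproj x + s *\<^sub>R u"
  by simp

lemma vgap_self [simp]: "vgap x x = 0"
  by (simp add: vgap_def)

lemma vgap_swap: "vgap q p = - vgap p q"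
  by (simp add: vgap_def symplectic_swap[of "hproj q"])

lemma vgap_flow_left: "vgap (x + s *\<^sub>R hfield u x) y = vgap x y + 2 * s * symplectic u (hproj y - hproj x)"
  by (simp add: vgap_def hproj_flow symplectic.add_left symplectic.scaleR_left symplectic.diff_right)
    (simp add: hfield_eq algebra_simps)

lemma vgap_flow_right: "vgap x (y + s *\<^sub>R hfield u y) = vgap x y + 2 * s * symplectic u (hproj y - hproj x)"
  using vgap_swap[of x "y + s *\<^sub>R hfield u y"] vgap_flow_left[of y s u x] vgap_swap[of x y]
  by (simp add: symplectic.diff_right algebra_simps)

lemma hfield_flow [simp]: "hfield u (x + s *\<^sub>R hfield u x) = hfield u x"
  unfolding hfield_eq[of u "x + s *\<^sub>R hfield u x"]
  by (simp add: symplectic.add_right symplectic.scaleR_right) (simp add: hfield_eq)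
   
lemma vgap_flow_directions:
  "vgap (x + s *\<^sub>R hfield u x) (x + t *\<^sub>R hfield v x) = 2 * s * t * symplectic u v"
  using symplectic_swap[of u v]
  by (simp add: vgap_flow_left vgap_flow_right symplectic.scaleR_right symplectic.minus_right symplectic.zero_right)

lemma vgap_flow_points:
  "vgap (x + t *\<^sub>R hfield u x) (y + t *\<^sub>R hfield u y) = vgap x y + 4 * t * symplectic u (hproj y - hproj x)"
  by (simp add: vgap_flow_left vgap_flow_right symplectic.scaleR_right symplectic.diff_right symplectic.add_right algebra_simps)

lemma norm_vector_derivative_le:
  fixes P :: "real \<Rightarrow> 'a::real_normed_vector"
  assumes P: "(P has_vector_derivative h) (at s within J)" and s: "s islimpt J"
    and lip: "\<And>y. y \<in> J \<Longrightarrow> norm (P y - P s) \<le> C * \<bar>y - s\<bar>"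
  shows "norm h \<le> C"
proof (rule field_le_epsilon)
  fix e :: real assume "e > 0"
  then obtain d where "d > 0" and d: "\<And>y. y \<in> J \<Longrightarrow> norm (y - s) < d \<Longrightarrow> norm (P y - P s - (y - s) *\<^sub>R h) \<le> e * norm (y - s)"
    using P unfolding has_vector_derivative_def has_derivative_within_alt by meson
  obtain y where y: "y \<in> J" "y \<noteq> s" "dist y s < d"
    using s \<open>d > 0\<close> islimpt_approachable by blast
  have "norm ((y - s) *\<^sub>R h) \<le> norm (P y - P s) + norm (P y - P s - (y - s) *\<^sub>R h)"
    using norm_triangle_ineq4[of "P y - P s" "P y - P s - (y - s) *\<^sub>R h"] by simp
  also have "\<dots> \<le> (C + e) * \<bar>y - s\<bar>"
    using lip[OF y(1)] d[of y] y by (simp add: dist_norm algebra_simps)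
  finally have "\<bar>y - s\<bar> * norm h \<le> \<bar>y - s\<bar> * (C + e)" by (simp add: mult.commute)
  then show "norm h \<le> C + e" using y(2) by simp
qed

text \<open>
  A Lipschitz horizontal curve that has a horizontal derivative at \<open>t0\<close> stays close to its tangent
  line, which is itself horizontal, in the sense of the homogeneous dilations: the horizontal error is
  \<open>o(t - t0)\<close> and the vertical error even \<open>o((t - t0)\<^sup>2)\<close>. The first is differentiability. For the
  second, the vertical gap between line and curve has almost everywhere the derivative
  \<open>2 * symplectic (h t + u) (\<rho> t)\<close>, where \<open>\<rho>\<close> is the horizontal error; \<open>h\<close> is bounded by the Lipschitz
  constant, so the derivative is \<open>o(t - t0)\<close>, and the gap is the integral of its derivative.
\<close>

theorem horizontal_curve_tangent_line:
  fixes u :: "(real, 'n::finite) vec \<times> (real, 'n) vec"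
  assumes hor: "horizontal_curve I \<gamma>" and lipc: "Lipschitz_curve I \<gamma>" and t0: "t0 \<in> interior I"
    and x: "\<gamma> t0 = x" and deriv: "(\<gamma> has_vector_derivative hfield u x) (at t0)" and "e > 0"
  shows "\<exists>d>0. \<forall>t. \<bar>t - t0\<bar> < d \<longrightarrow>
    norm (hproj (\<gamma> t) - hproj (x + (t - t0) *\<^sub>R hfield u x)) \<le> e * \<bar>t - t0\<bar> \<and>
    \<bar>vgap (x + (t - t0) *\<^sub>R hfield u x) (\<gamma> t)\<bar> \<le> e * (t - t0)\<^sup>2"
proof -
  obtain C where "C \<ge> 0" and C: "\<And>s t. s \<in> I \<Longrightarrow> t \<in> I \<Longrightarrow> ccdist (\<gamma> s) (\<gamma> t) \<le> C * \<bar>s - t\<bar>"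
    using lipc unfolding Lipschitz_curve_def by blast
  obtain h where h: "horizontal_with I \<gamma> h" using hor unfolding horizontal_curve_def by blast
  define P where "P t = hproj (\<gamma> t)" for t
  have PC: "norm (P t - P s) \<le> C * \<bar>t - s\<bar>" if "s \<in> I" "t \<in> I" for s t
    using ccdist_lower(1)[of "\<gamma> t" "\<gamma> s"] C[OF that] by (simp add: P_def abs_minus_commute)
  define \<rho> where "\<rho> t = P t - P t0 - (t - t0) *\<^sub>R u" for t
  \<comment> \<open>\<open>M\<close> exceeds the factor \<open>2 * norm (h t + u)\<close> in the derivative of the vertical gap\<close>
  define M where "M = 2 * (C + norm u) + 1"
  have "M \<ge> 1" using \<open>C \<ge> 0\<close> by (simp add: M_def)
  have "e / M > 0" using \<open>e > 0\<close> \<open>M \<ge> 1\<close> by simp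
  have "(P has_vector_derivative u) (at t0)"
    using bounded_linear.has_vector_derivative[OF bounded_linear_hproj deriv] by (simp add: P_def[abs_def])
  then obtain d1 where "d1 > 0" and d1: "\<And>y. norm (y - t0) < d1 \<Longrightarrow> norm (P y - P t0 - (y - t0) *\<^sub>R u) \<le> e / M * norm (y - t0)"
    using \<open>e / M > 0\<close> unfolding has_vector_derivative_def has_derivative_within_alt by (meson UNIV_I)
  obtain d2 where "d2 > 0" and d2: "ball t0 d2 \<subseteq> I"
    using t0 by (meson mem_interior)
  define d where "d = min d1 d2"
  have "d > 0" using \<open>d1 > 0\<close> \<open>d2 > 0\<close> by (simp add: d_def)
  have inI: "t \<in> I" if "\<bar>t - t0\<bar> < d" for t
    using that d2 by (auto simp: d_def ball_def dist_real_def abs_minus_commute)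
  have \<rho>: "norm (\<rho> t) \<le> e / M * \<bar>t - t0\<bar>" if "\<bar>t - t0\<bar> < d" for t
    using d1[of t] that by (simp add: \<rho>_def d_def)
  have flow: "hproj (\<gamma> t) - hproj (x + (t - t0) *\<^sub>R hfield u x) = \<rho> t" for t
    by (simp add: \<rho>_def P_def x)
  define L where "L p = snd (snd p) + 2 * symplectic (hproj x) (hproj p)" for p
  have L: "bounded_linear L"
    unfolding L_def
    by (intro bounded_linear_add bounded_linear_compose[OF bounded_linear_snd bounded_linear_snd]
      bounded_linear_const_mult bounded_linear_compose[OF symplectic.bounded_linear_right bounded_linear_hproj])
  define G where "G t = 2 * (t - t0) * symplectic u (P t - P t0) - snd (snd x)" for t
  define w where "w t = L (\<gamma> t) + G t" for t
  have w: "vgap (x + (t - t0) *\<^sub>R hfield u x) (\<gamma> t) = w t" for t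
    by (simp add: w_def L_def G_def vgap_flow_left P_def x vgap_def[of x])
  have w0: "w t0 = 0" using w[of t0] by (simp add: x)
  have main: "\<bar>w t\<bar> \<le> e * (t - t0)\<^sup>2" if t: "\<bar>t - t0\<bar> < d" "t \<noteq> t0" for t
  proof -
    define l r where "l = min t t0" and "r = max t t0"
    have lr: "l < r" "r - l = \<bar>t - t0\<bar>" using t(2) by (auto simp: l_def r_def)
    have J: "\<bar>s - t0\<bar> \<le> \<bar>t - t0\<bar>" if "s \<in> {l..r}" for s using that by (auto simp: l_def r_def)
    have JI: "{l..r} \<subseteq> I" using J inI t(1) by (meson le_less_trans subsetI)
    have t0I: "t0 \<in> I" using inI[of t0] \<open>d > 0\<close> by simp
    define Z where "Z = {s. \<not> (s \<in> I \<longrightarrow> (\<gamma> has_vector_derivative hfield (h s) (\<gamma> s)) (at s within I))}"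
    have "AE s in lebesgue. s \<in> I \<longrightarrow> (\<gamma> has_vector_derivative hfield (h s) (\<gamma> s)) (at s within I)"
      using h by (simp add: horizontal_with_def)
    then have Z: "negligible Z"
      unfolding Z_def by (simp add: negligible_iff_null_sets completion.AE_iff_null_sets)
    \<comment> \<open>set to \<open>0\<close> on the null set, so that the bound below holds at every point\<close>
    define w' where "w' s = (if s \<in> Z then 0 else 2 * symplectic (h s + u) (\<rho> s))" for s
    have d\<gamma>: "(\<gamma> has_vector_derivative hfield (h s) (\<gamma> s)) (at s within {l..r})" if "s \<in> {l..r} - Z" for s
      using that JI by (auto simp: Z_def intro: has_vector_derivative_within_subset)
    have dP: "(P has_vector_derivative h s) (at s within {l..r})" if "s \<in> {l..r} - Z" for s
      using bounded_linear.has_vector_derivative[OF bounded_linear_hproj d\<gamma>[OF that]] by (simp add: P_def[abs_def])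
    have hC: "norm (h s) \<le> C" if "s \<in> {l..r} - Z" for s
    proof (rule norm_vector_derivative_le[OF dP[OF that]])
      show "s islimpt {l..r}" using that lr(1) by (simp add: islimpt_Icc)
      show "norm (P y - P s) \<le> C * \<bar>y - s\<bar>" if "y \<in> {l..r}" for y
        using that \<open>s \<in> {l..r} - Z\<close> JI by (intro PC) (auto dest: subsetD)
    qed
    have dw: "(w has_vector_derivative w' s) (at s within {l..r})" if s: "s \<in> {l..r} - Z" for s
    proof -
      have 1: "((\<lambda>s. L (\<gamma> s)) has_vector_derivative L (hfield (h s) (\<gamma> s))) (at s within {l..r})"
        by (rule bounded_linear.has_vector_derivative[OF L d\<gamma>[OF s]])
      have "((\<lambda>s. symplectic u (P s - P t0)) has_vector_derivative symplectic u (h s)) (at s within {l..r})"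
        using bounded_linear.has_vector_derivative[OF symplectic.bounded_linear_right, of "\<lambda>s. P s - P t0" "h s" _ u]
          has_vector_derivative_diff[OF dP[OF s] has_vector_derivative_const[of "P t0"]] by simp
      then have "(G has_real_derivative (2 * symplectic u (P s - P t0) + 2 * (s - t0) * symplectic u (h s))) (at s within {l..r})"
        unfolding G_def has_real_derivative_iff_has_vector_derivative[symmetric]
        by (auto intro!: derivative_eq_intros)
      then have 2: "(G has_vector_derivative (2 * symplectic u (P s - P t0) + 2 * (s - t0) * symplectic u (h s))) (at s within {l..r})"
        by (simp add: has_real_derivative_iff_has_vector_derivative)
      have "P s - P t0 = \<rho> s + (s - t0) *\<^sub>R u" by (simp add: \<rho>_def)
      moreover have "L (hfield (h s) (\<gamma> s)) = 2 * symplectic (h s) (P s - P t0)"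
        using symplectic_swap[of "h s" "hproj x"] by (simp add: L_def P_def x hfield_eq symplectic.diff_right)
      ultimately have "L (hfield (h s) (\<gamma> s)) + (2 * symplectic u (P s - P t0) + 2 * (s - t0) * symplectic u (h s)) = w' s"
        using s symplectic_swap[of "h s" u] by (simp add: w'_def symplectic.add_left symplectic.add_right symplectic.scaleR_right)
      then show ?thesis using has_vector_derivative_add[OF 1 2] by (simp add: w_def[abs_def])
    qed
    have ACw: "absolutely_continuous_curve {l..r} w"
      unfolding w_def
    proof (rule absolutely_continuous_curve_bounded_linear_add[OF _ L])
      show "absolutely_continuous_curve {l..r} \<gamma>"
        using h JI by (auto simp: horizontal_with_def intro: absolutely_continuous_curve_subset)
      show "absolutely_continuous_curve {l..r} G"
      proof (rule absolutely_continuous_curve_lipschitz)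
        fix s s' assume s: "s \<in> {l..r}" "s' \<in> {l..r}"
        have sI: "s \<in> I" "s' \<in> I" using s JI by auto
        have sd: "\<bar>s - t0\<bar> \<le> d" "\<bar>s' - t0\<bar> \<le> d" using J[OF s(1)] J[OF s(2)] t(1) by auto
        have "G s - G s' = 2 * ((s - s') * symplectic u (P s - P t0) + (s' - t0) * symplectic u (P s - P s'))"
          by (simp add: G_def symplectic.diff_right algebra_simps)
        then have "\<bar>G s - G s'\<bar> \<le> 2 * (\<bar>s - s'\<bar> * \<bar>symplectic u (P s - P t0)\<bar> + \<bar>s' - t0\<bar> * \<bar>symplectic u (P s - P s')\<bar>)"
          by (simp add: abs_mult[symmetric] abs_triangle_ineq)
        moreover have "\<bar>symplectic u (P s - P t0)\<bar> \<le> norm u * (C * d)"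
          using symplectic_le[of u "P s - P t0"] PC[OF t0I sI(1)] sd \<open>C \<ge> 0\<close>
          by (meson mult_left_mono norm_ge_zero order_trans)
        moreover have "\<bar>symplectic u (P s - P s')\<bar> \<le> norm u * (C * \<bar>s - s'\<bar>)"
          using symplectic_le[of u "P s - P s'"] PC[OF sI(2,1)]
          by (meson mult_left_mono norm_ge_zero order_trans)
        ultimately have "\<bar>G s - G s'\<bar> \<le> 2 * (\<bar>s - s'\<bar> * (norm u * (C * d)) + d * (norm u * (C * \<bar>s - s'\<bar>)))"
          using sd by (smt (verit, ccfv_SIG) abs_ge_zero mult_mono)
        then show "dist (G s) (G s') \<le> 4 * norm u * C * d * \<bar>s - s'\<bar>"
          by (simp add: dist_real_def algebra_simps)
      qed
    qed
    have "(w' has_integral (w r - w l)) {l..r}"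
      by (rule absolutely_continuous_has_integral[OF _ ACw Z dw]) (use lr in auto)
    then have "norm (w r - w l) \<le> (e * \<bar>t - t0\<bar>) * measure lborel {l..r}"
    proof (rule has_integral_bound_real[where S="{}", rotated 2])
      fix s assume s: "s \<in> {l..r} - {}"
      show "norm (w' s) \<le> e * \<bar>t - t0\<bar>"
      proof (cases "s \<in> Z")
        case True
        then show ?thesis using \<open>e > 0\<close> by (simp add: w'_def)
      next
        case False
        have "norm (w' s) \<le> 2 * (norm (h s + u) * norm (\<rho> s))"
          using symplectic_le[of "h s + u" "\<rho> s"] False by (simp add: w'_def)
        also have "\<dots> \<le> 2 * ((C + norm u) * (e / M * \<bar>t - t0\<bar>))"
        proof (intro mult_left_mono mult_mono)
          show "norm (h s + u) \<le> C + norm u" using hC[of s] s False norm_triangle_ineq[of "h s" u] by auto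
          have "norm (\<rho> s) \<le> e / M * \<bar>s - t0\<bar>" using \<rho>[of s] J[of s] s t by auto
          also have "\<dots> \<le> e / M * \<bar>t - t0\<bar>" using J[of s] s \<open>e / M > 0\<close> by (intro mult_left_mono) auto
          finally show "norm (\<rho> s) \<le> e / M * \<bar>t - t0\<bar>" .
        qed (use \<open>C \<ge> 0\<close> in auto)
        also have "\<dots> = (2 * (C + norm u) / M) * (e * \<bar>t - t0\<bar>)" by simp
        also have "\<dots> \<le> 1 * (e * \<bar>t - t0\<bar>)"
          using \<open>M \<ge> 1\<close> \<open>e > 0\<close> by (intro mult_right_mono) (auto simp: M_def)
        finally show ?thesis by simp
      qed
    qed (use \<open>e > 0\<close> in auto)
    moreover have "\<bar>w r - w l\<bar> = \<bar>w t\<bar>" using w0 by (auto simp: l_def r_def min_def max_def)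
    moreover have "measure lborel {l..r} = \<bar>t - t0\<bar>" using lr by simp
    ultimately show ?thesis by (simp add: power2_eq_square mult.assoc)
  qed
  show ?thesis
  proof (intro exI[of _ d] conjI allI impI \<open>d > 0\<close>)
    fix t assume t: "\<bar>t - t0\<bar> < d"
    have "norm (\<rho> t) \<le> e / M * \<bar>t - t0\<bar>" by (rule \<rho>[OF t])
    also have "\<dots> \<le> e * \<bar>t - t0\<bar>"
      using \<open>M \<ge> 1\<close> \<open>e > 0\<close> by (intro mult_right_mono) (auto simp: divide_le_eq)
    finally show "norm (hproj (\<gamma> t) - hproj (x + (t - t0) *\<^sub>R hfield u x)) \<le> e * \<bar>t - t0\<bar>" unfolding flow .
    show "\<bar>vgap (x + (t - t0) *\<^sub>R hfield u x) (\<gamma> t)\<bar> \<le> e * (t - t0)\<^sup>2"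
      unfolding w using main[OF t] w0 by (cases "t = t0") auto
  qed
qed

lemma Lipschitz_fun_coordinates:
  assumes "Lipschitz_fun f"
  shows "\<exists>C>0. \<forall>x y. \<bar>f x - f y\<bar> \<le> C * (norm (hproj y - hproj x) + 380 * sqrt \<bar>vgap x y\<bar>)"
proof -
  obtain C where "C \<ge> 0" and C: "\<And>x y. \<bar>f x - f y\<bar> \<le> C * ccdist x y"
    using assms unfolding Lipschitz_fun_def by blast
  show ?thesis
  proof (intro exI[of _ "C + 1"] conjI allI)
    show "C + 1 > 0" using \<open>C \<ge> 0\<close> by simp
    show "\<bar>f x - f y\<bar> \<le> (C + 1) * (norm (hproj y - hproj x) + 380 * sqrt \<bar>vgap x y\<bar>)" for x y
    proof -
      have "\<bar>f x - f y\<bar> \<le> (C + 1) * ccdist x y" using C[of x y] ccdist_nonneg[of x y] by (simp add: distrib_right)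
      also have "\<dots> \<le> (C + 1) * (norm (hproj y - hproj x) + 380 * sqrt \<bar>vgap x y\<bar>)"
        using \<open>C \<ge> 0\<close> by (intro mult_left_mono ccdist_le_coordinates) simp
      finally show ?thesis .
    qed
  qed
qed

text \<open>
  A Lipschitz function varies by at most a constant times the horizontal distance plus the square root
  of the vertical gap. Hence its values on a curve and on the tangent line differ by \<open>o(t - t0)\<close>, and
  the two derivatives agree. In particular the horizontal derivative is unique.
\<close>

theorem has_hderiv_iff:
  assumes f: "Lipschitz_fun f"
  shows "has_hderiv f (hfield u) x D \<longleftrightarrow> ((\<lambda>s. f (x + s *\<^sub>R hfield u x)) has_real_derivative D) (at 0)"
proof
  assume "((\<lambda>s. f (x + s *\<^sub>R hfield u x)) has_real_derivative D) (at 0)"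
  define \<gamma> where "\<gamma> s = x + s *\<^sub>R hfield u x" for s
  have d: "(\<gamma> has_vector_derivative hfield u x) (at s)" for s
    unfolding \<gamma>_def by (auto intro!: derivative_eq_intros)
  have "horizontal_with UNIV \<gamma> (\<lambda>_. u)"
    unfolding horizontal_with_def
  proof (intro conjI)
    show "absolutely_continuous_curve UNIV \<gamma>"
    proof (rule absolutely_continuous_curve_lipschitz)
      show "dist (\<gamma> s) (\<gamma> t) \<le> norm (hfield u x) * \<bar>s - t\<bar>" for s t
        by (simp add: \<gamma>_def dist_norm scaleR_diff_left[symmetric] del: scaleR_diff_left)
    qed
    show "AE t in lebesgue. t \<in> UNIV \<longrightarrow> (\<gamma> has_vector_derivative hfield u (\<gamma> t)) (at t)"
      using d by (simp add: \<gamma>_def[abs_def])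
  qed auto
  then have hor: "horizontal_curve UNIV \<gamma>" unfolding horizontal_curve_def by blast
  have lip: "Lipschitz_curve UNIV \<gamma>"
    unfolding Lipschitz_curve_def
  proof (intro exI[of _ "norm u"] conjI ballI)
    fix s t :: real
    have "ccdist (\<gamma> s) (\<gamma> t) \<le> norm (hproj (\<gamma> t) - hproj (\<gamma> s)) + 380 * sqrt \<bar>vgap (\<gamma> s) (\<gamma> t)\<bar>"
      by (rule ccdist_le_coordinates)
    also have "\<dots> = norm u * \<bar>s - t\<bar>"
      by (simp add: \<gamma>_def vgap_flow_directions scaleR_diff_left[symmetric] abs_minus_commute mult.commute del: scaleR_diff_left)
    finally show "ccdist (\<gamma> s) (\<gamma> t) \<le> norm u * \<bar>s - t\<bar>" .
  qed simp
  show "has_hderiv f (hfield u) x D"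
    unfolding has_hderiv_def
    using hor lip d[of 0] \<open>((\<lambda>s. f (x + s *\<^sub>R hfield u x)) has_real_derivative D) (at 0)\<close>
    by (intro exI[of _ UNIV] exI[of _ \<gamma>] exI[of _ "0::real"]) (simp add: \<gamma>_def o_def)
next
  assume "has_hderiv f (hfield u) x D"
  then obtain I \<gamma> t0 where hor: "horizontal_curve I \<gamma>" and lipc: "Lipschitz_curve I \<gamma>" and t0: "t0 \<in> interior I"
    and x: "\<gamma> t0 = x" and deriv: "(\<gamma> has_vector_derivative hfield u x) (at t0)"
    and D: "((f \<circ> \<gamma>) has_real_derivative D) (at t0)"
    unfolding has_hderiv_def by blast
  obtain C where "C > 0" and C: "\<And>x y. \<bar>f x - f y\<bar> \<le> C * (norm (hproj y - hproj x) + 380 * sqrt \<bar>vgap x y\<bar>)"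
    using Lipschitz_fun_coordinates[OF f] by blast
  define g where "g s = f (x + s *\<^sub>R hfield u x) - f (\<gamma> (t0 + s))" for s
  have g0: "g 0 = 0" by (simp add: g_def x)
  have "(g has_real_derivative 0) (at 0)"
    unfolding has_field_derivative_def has_derivative_within_alt
  proof (intro conjI allI impI)
    fix e :: real assume "e > 0"
    define e' where "e' = min (e / (2 * C)) ((e / (760 * C))\<^sup>2)"
    have "e' > 0" using \<open>e > 0\<close> \<open>C > 0\<close> by (simp add: e'_def)
    obtain d where "d > 0" and d: "\<And>t. \<bar>t - t0\<bar> < d \<Longrightarrow>
       norm (hproj (\<gamma> t) - hproj (x + (t - t0) *\<^sub>R hfield u x)) \<le> e' * \<bar>t - t0\<bar> \<and>
       \<bar>vgap (x + (t - t0) *\<^sub>R hfield u x) (\<gamma> t)\<bar> \<le> e' * (t - t0)\<^sup>2"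
      using horizontal_curve_tangent_line[OF hor lipc t0 x deriv \<open>e' > 0\<close>] by blast
    show "\<exists>d>0. \<forall>y\<in>UNIV. norm (y - 0) < d \<longrightarrow> norm (g y - g 0 - 0 * (y - 0)) \<le> e * norm (y - 0)"
    proof (intro exI[of _ d] conjI ballI impI \<open>d > 0\<close>)
      fix s :: real assume "norm (s - 0) < d"
      then have s: "norm (hproj (\<gamma> (t0 + s)) - hproj (x + s *\<^sub>R hfield u x)) \<le> e' * \<bar>s\<bar>"
        "\<bar>vgap (x + s *\<^sub>R hfield u x) (\<gamma> (t0 + s))\<bar> \<le> e' * s\<^sup>2"
        using d[of "t0 + s"] by simp_all
      have "sqrt \<bar>vgap (x + s *\<^sub>R hfield u x) (\<gamma> (t0 + s))\<bar> \<le> sqrt ((e / (760 * C))\<^sup>2 * s\<^sup>2)"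
        using order_trans[OF s(2) mult_right_mono[of e' "(e / (760 * C))\<^sup>2"]]
        by (intro real_sqrt_le_mono) (simp add: e'_def)
      also have "\<dots> = e / (760 * C) * \<bar>s\<bar>"
        using \<open>e > 0\<close> \<open>C > 0\<close> by (simp add: real_sqrt_mult)
      finally have 1: "sqrt \<bar>vgap (x + s *\<^sub>R hfield u x) (\<gamma> (t0 + s))\<bar> \<le> e / (760 * C) * \<bar>s\<bar>" .
      have 2: "norm (hproj (\<gamma> (t0 + s)) - hproj (x + s *\<^sub>R hfield u x)) \<le> e / (2 * C) * \<bar>s\<bar>"
        using order_trans[OF s(1) mult_right_mono[of e' "e / (2 * C)"]] by (simp add: e'_def)
      have "\<bar>g s\<bar> \<le> C * (e / (2 * C) * \<bar>s\<bar> + 380 * (e / (760 * C) * \<bar>s\<bar>))"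
        unfolding g_def using 1 2 \<open>C > 0\<close> by (intro order_trans[OF C] mult_left_mono add_mono) auto
      also have "\<dots> = e * \<bar>s\<bar>" using \<open>C > 0\<close> by (simp add: field_simps)
      finally show "norm (g s - g 0 - 0 * (s - 0)) \<le> e * norm (s - 0)" by (simp add: g0)
    qed
  qed (simp add: bounded_linear_mult_right)
  moreover have "((\<lambda>s. f (\<gamma> (t0 + s))) has_real_derivative D) (at 0)"
    using D DERIV_shift[of "f \<circ> \<gamma>" D 0 t0] by (simp add: o_def add.commute)
  ultimately have "((\<lambda>s. g s + f (\<gamma> (t0 + s))) has_real_derivative (0 + D)) (at 0)"
    by (rule DERIV_add)
  then show "((\<lambda>s. f (x + s *\<^sub>R hfield u x)) has_real_derivative D) (at 0)" by (simp add: g_def)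
qed

section \<open>A variational principle for directional derivatives\<close>

text \<open>
  If \<open>g\<close> is linear near \<open>0\<close> up to arbitrarily small relative errors, then the approximate slopes
  form a Cauchy sequence and their limit is the derivative.
\<close>

lemma has_real_derivative_of_approximations:
  fixes g :: "real \<Rightarrow> real"
  assumes g0: "g 0 = 0" and \<eta>: "\<eta> \<longlonglongrightarrow> 0"
    and c: "\<And>m::nat. \<forall>\<^sub>F t in at 0. \<bar>g t - c m * t\<bar> \<le> \<eta> m * \<bar>t\<bar>"
  obtains d where "(g has_real_derivative d) (at 0)" and "c \<longlonglongrightarrow> d"
proof -
  have cc: "\<bar>c m - c k\<bar> \<le> \<eta> m + \<eta> k" for m k
  proof -
    have "\<forall>\<^sub>F t in at (0::real). t \<noteq> 0" by (rule eventually_neq_at_within)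
    with c[of m] c[of k] have "\<forall>\<^sub>F t in at (0::real). \<bar>c m - c k\<bar> \<le> \<eta> m + \<eta> k"
    proof eventually_elim
      case (elim t)
      have "\<bar>c m - c k\<bar> * \<bar>t\<bar> = \<bar>(g t - c k * t) - (g t - c m * t)\<bar>"
        by (simp add: abs_mult[symmetric] algebra_simps)
      also have "\<dots> \<le> (\<eta> m + \<eta> k) * \<bar>t\<bar>" using elim(1,2) by (simp add: distrib_right)
      finally show ?case using elim(3) by simp
    qed
    then show ?thesis by simp
  qed
  have "Cauchy c"
  proof (rule CauchyI)
    fix e :: real assume "e > 0"
    obtain M where M: "\<And>m. m \<ge> M \<Longrightarrow> \<bar>\<eta> m\<bar> < e / 2"
      using LIMSEQ_D[OF \<eta> half_gt_zero[OF \<open>e > 0\<close>]] by auto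
    have "norm (c m - c k) < e" if "m \<ge> M" "k \<ge> M" for m k
      using cc[of m k] M[OF that(1)] M[OF that(2)] by auto
    then show "\<exists>M. \<forall>m\<ge>M. \<forall>k\<ge>M. norm (c m - c k) < e" by blast
  qed
  then obtain d where d: "c \<longlonglongrightarrow> d" using Cauchy_convergent convergent_def by blast
  have cd: "\<bar>c m - d\<bar> \<le> \<eta> m" for m
  proof (rule LIMSEQ_le)
    show "(\<lambda>k. \<bar>c m - c k\<bar>) \<longlonglongrightarrow> \<bar>c m - d\<bar>" using d by (intro tendsto_intros)
    show "(\<lambda>k. \<eta> m + \<eta> k) \<longlonglongrightarrow> \<eta> m" using tendsto_add[OF tendsto_const \<eta>, of "\<eta> m"] by simp
    show "\<exists>M. \<forall>k\<ge>M. \<bar>c m - c k\<bar> \<le> \<eta> m + \<eta> k" using cc by blast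
  qed
  have "(\<lambda>t. g t / t) \<midarrow>0\<rightarrow> d"
  proof (rule tendstoI)
    fix e :: real assume "e > 0"
    obtain m where m: "\<bar>\<eta> m\<bar> < e / 2"
      using LIMSEQ_D[OF \<eta> half_gt_zero[OF \<open>e > 0\<close>]] by auto
    have "\<forall>\<^sub>F t in at (0::real). t \<noteq> 0" by (rule eventually_neq_at_within)
    with c[of m] show "\<forall>\<^sub>F t in at 0. dist (g t / t) d < e"
    proof eventually_elim
      case (elim t)
      have "\<bar>g t / t - c m\<bar> \<le> \<eta> m"
      proof -
        have "\<bar>g t / t - c m\<bar> = \<bar>g t - c m * t\<bar> / \<bar>t\<bar>"
          using elim(2) by (simp add: abs_divide[symmetric] diff_divide_distrib)
        also have "\<dots> \<le> \<eta> m" using elim by (simp add: divide_le_eq)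
        finally show ?thesis .
      qed
      then show ?case using cd[of m] m by (simp add: dist_real_def)
    qed
  qed
  then have "(g has_real_derivative d) (at 0)"
    by (simp add: has_field_derivative_iff g0)
  with d show thesis by (rule that[rotated])
qed

lemma has_real_derivative_eventually_close:
  fixes g :: "real \<Rightarrow> real"
  assumes "(g has_real_derivative d) (at 0)" "g 0 = 0" "e > 0"
  shows "\<exists>r>0. \<forall>t. \<bar>t\<bar> < r \<longrightarrow> \<bar>g t - d * t\<bar> \<le> e * \<bar>t\<bar>"
  using assms unfolding has_field_derivative_def has_derivative_within_alt by fastforce

lemma norm_diff_unit:
  fixes u v :: "'a::real_inner"
  assumes "norm u = 1" "norm v = 1"
  shows "(norm (u - v))\<^sup>2 = 2 * (1 - u \<bullet> v)"
  using assms by (simp add: power2_norm_eq_inner inner_diff inner_commute norm_eq_1)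

text \<open>
  Here \<open>\<Delta> x u t\<close> stands for the increment of a function from \<open>x\<close> to the point at time \<open>t\<close> on the line
  through \<open>x\<close> in direction \<open>u\<close>. Adding a linear function with gradient \<open>L\<close> changes the slope
  \<open>\<phi> x u\<close> to \<open>\<phi> x u + L \<bullet> u\<close> and leaves the domain \<open>D\<close> and all differences of increments in a common
  direction unchanged.

  The proof is a Borwein-Preiss type argument. A sequence \<open>(X m, U m)\<close> in \<open>D\<close> is built such that
  \<open>(X m, U m)\<close> almost maximizes, up to \<open>lam m\<close>, the penalized slope
  \<open>q m x u = \<phi> x u - (\<Sum>k<m. \<tau> k * (1 - U k \<bullet> u))\<close> on a set \<open>S m\<close> of admissible pairs. For unit vectors
  \<open>1 - U k \<bullet> u\<close> is half the squared distance of \<open>U k\<close> and \<open>u\<close>, so almost maximality forces the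
  directions to converge; at the same time the penalties add up to a linear perturbation of the slope
  with gradient \<open>L = (\<Sum>k. \<tau> k * U k)\<close>. A pair \<open>(x, u)\<close> is admissible at stage \<open>m\<close> if for every
  \<open>j < m\<close> the point \<open>x\<close> lies in a small ball around \<open>X j\<close>, the penalized slope has not dropped below
  \<open>a j = q j (X j) (U j)\<close>, and the increments in direction \<open>U j\<close> from \<open>X j\<close> and from \<open>x\<close> differ by at most
  \<open>(\<sigma> j + \<kappa> (q m x u - a j)) * \<bar>t\<bar>\<close>. The balls shrink inside the open sets that define \<open>N\<close>, which puts the
  limit point into \<open>N\<close>. Almost maximality bounds the argument of \<open>\<kappa>\<close> by \<open>lam j\<close> along the sequence, so
  the last condition transfers differentiability to the limit.

  If a pair \<open>(x, u)\<close> near the limit satisfied the comparison condition and had a slope larger by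
  \<open>\<epsilon>\<close>, it would be admissible at any given stage \<open>m\<close>, provided that \<open>x\<close> is close enough to the limit; for
  \<open>lam m < \<epsilon>\<close> this contradicts almost maximality. In the last condition of admissibility, increments at small \<open>t\<close> are
  controlled by differentiability at \<open>X j\<close> and at the limit, together with the comparison condition;
  at the remaining \<open>t\<close> they are controlled by continuity, for which the strict monotonicity of \<open>\<kappa>\<close>
  leaves room because the slope increased by at least \<open>\<epsilon>\<close>.
\<close>

theorem almost_locally_maximal_direction:
  fixes \<Delta> :: "'a::complete_space \<Rightarrow> 'b::euclidean_space \<Rightarrow> real \<Rightarrow> real"
    and \<kappa> :: "real \<Rightarrow> real" and N W :: "'a set" and x0 :: 'a and u0 :: 'b
  defines "\<phi> \<equiv> \<lambda>x u. deriv (\<Delta> x u) 0"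
    and "D \<equiv> {(x, u). x \<in> N \<and> norm u = 1 \<and> (\<exists>d. (\<Delta> x u has_real_derivative d) (at 0))}"
  assumes N: "gdelta N" and W: "open W" and \<mu>: "\<mu> > 0"
    and bounded: "\<And>x u t. norm u = 1 \<Longrightarrow> \<bar>t\<bar> < 1 \<Longrightarrow> \<bar>\<Delta> x u t\<bar> \<le> B * \<bar>t\<bar>"
    and direction: "\<And>e. e > 0 \<Longrightarrow> \<exists>s>0. \<forall>x u v t. norm u = 1 \<and> norm v = 1 \<and> norm (u - v) \<le> s \<and> \<bar>t\<bar> < 1 \<longrightarrow>
      \<bar>\<Delta> x u t - \<Delta> x v t\<bar> \<le> e * \<bar>t\<bar>"
    and point: "\<And>x u e. norm u = 1 \<Longrightarrow> e > 0 \<Longrightarrow> \<forall>\<^sub>F y in nhds x. \<forall>t. \<bar>t\<bar> < 1 \<longrightarrow> \<bar>\<Delta> y u t - \<Delta> x u t\<bar> \<le> e"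
    and \<kappa>cont: "continuous_on {0..} \<kappa>" and \<kappa>mono: "strict_mono_on {0..} \<kappa>" and \<kappa>0: "\<kappa> 0 = 0"
    and init: "(x0, u0) \<in> D" "x0 \<in> W"
  obtains L x\<^sub>s u\<^sub>s where "norm L \<le> \<mu>" and "(x\<^sub>s, u\<^sub>s) \<in> D" and "x\<^sub>s \<in> W"
    and "\<phi> x\<^sub>s u\<^sub>s + L \<bullet> u\<^sub>s > \<phi> x0 u0"
    and "\<forall>\<epsilon>>0. \<forall>\<^sub>F x in nhds x\<^sub>s. \<forall>u. (x, u) \<in> D \<longrightarrow> \<phi> x u + L \<bullet> u \<ge> \<phi> x\<^sub>s u\<^sub>s + L \<bullet> u\<^sub>s \<longrightarrow>
      (\<forall>t. \<bar>t\<bar> < 1 \<longrightarrow> \<bar>\<Delta> x u\<^sub>s t - \<Delta> x\<^sub>s u\<^sub>s t\<bar>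
         \<le> \<kappa> ((\<phi> x u + L \<bullet> u) - (\<phi> x\<^sub>s u\<^sub>s + L \<bullet> u\<^sub>s)) * \<bar>t\<bar>) \<longrightarrow>
      \<phi> x u + L \<bullet> u < \<phi> x\<^sub>s u\<^sub>s + L \<bullet> u\<^sub>s + \<epsilon>"
proof -
  have \<Delta>0: "\<Delta> x u 0 = 0" if "norm u = 1" for x u using bounded[OF that, of 0 x] by simp
  have \<phi>: "(\<Delta> x u has_real_derivative \<phi> x u) (at 0)" if "(x, u) \<in> D" for x u
    using that unfolding D_def \<phi>_def by (auto dest: DERIV_imp_deriv)
  have unit: "norm u = 1" if "(x, u) \<in> D" for x u using that by (simp add: D_def)
  have \<phi>B: "\<phi> x u \<le> B" if xu: "(x, u) \<in> D" for x u
  proof (rule field_le_epsilon)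
    fix e :: real assume "e > 0"
    obtain r where "r > 0" and r: "\<And>t. \<bar>t\<bar> < r \<Longrightarrow> \<bar>\<Delta> x u t - \<phi> x u * t\<bar> \<le> e * \<bar>t\<bar>"
      using has_real_derivative_eventually_close[OF \<phi>[OF xu] \<Delta>0[OF unit[OF xu]] \<open>e > 0\<close>] by blast
    define t where "t = min (r/2) (1/2)"
    have t: "0 < t" "\<bar>t\<bar> < r" "\<bar>t\<bar> < 1" using \<open>r > 0\<close> by (auto simp: t_def)
    have "\<phi> x u * t \<le> (B + e) * t"
      using r[OF t(2)] bounded[OF unit[OF xu] t(3), of x] t(1) by (simp add: distrib_right)
    then show "\<phi> x u \<le> B + e" using t(1) by simp
  qed
  obtain O' :: "nat \<Rightarrow> 'a set" where O': "\<And>n. open (O' n)" "N = (\<Inter>n. O' n)"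
    using N by (auto elim: gdelta.cases)
  define \<sigma> :: "nat \<Rightarrow> real" where "\<sigma> j = (1/2)^j" for j
  define \<tau> :: "nat \<Rightarrow> real" where "\<tau> j = \<mu> * (1/2)^Suc j" for j
  have \<sigma>: "\<sigma> j > 0" "\<sigma> j \<le> 1" for j by (auto simp: \<sigma>_def power_le_one)
  have \<sigma>lim: "\<sigma> \<longlonglongrightarrow> 0" unfolding \<sigma>_def by (intro LIMSEQ_realpow_zero) auto
  have \<tau>: "\<tau> j > 0" for j using \<mu> by (simp add: \<tau>_def)
  have \<tau>sums: "\<tau> sums \<mu>"
    unfolding \<tau>_def using sums_mult[OF power_half_series, of \<mu>] by simp
  have \<tau>le: "sum \<tau> {..<m} \<le> \<mu>" for m
    using sum_le_suminf[OF sums_summable[OF \<tau>sums], of "{..<m}"] \<tau> sums_unique[OF \<tau>sums] by (simp add: less_imp_le)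
  have "\<exists>s>0. s \<le> \<sigma> j / (8 * (\<mu> + 1)) \<and> (\<forall>x u v t. norm u = 1 \<and> norm v = 1 \<and> norm (u - v) \<le> s \<and> \<bar>t\<bar> < 1 \<longrightarrow>
      \<bar>\<Delta> x u t - \<Delta> x v t\<bar> \<le> \<sigma> j / 4 * \<bar>t\<bar>)" for j
  proof -
    obtain s where "s > 0" "\<forall>x u v t. norm u = 1 \<and> norm v = 1 \<and> norm (u - v) \<le> s \<and> \<bar>t\<bar> < 1 \<longrightarrow>
      \<bar>\<Delta> x u t - \<Delta> x v t\<bar> \<le> \<sigma> j / 4 * \<bar>t\<bar>"
      using direction[of "\<sigma> j / 4"] \<sigma>[of j] by auto
    then show ?thesis
      using \<sigma>[of j] \<mu> by (intro exI[of _ "min s (\<sigma> j / (8 * (\<mu> + 1)))"]) auto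
  qed
  then obtain s where s: "\<And>j. s j > 0" "\<And>j. s j \<le> \<sigma> j / (8 * (\<mu> + 1))"
    and sdir: "\<And>j x u v t. norm u = 1 \<Longrightarrow> norm v = 1 \<Longrightarrow> norm (u - v) \<le> s j \<Longrightarrow> \<bar>t\<bar> < 1 \<Longrightarrow>
      \<bar>\<Delta> x u t - \<Delta> x v t\<bar> \<le> \<sigma> j / 4 * \<bar>t\<bar>"
    by metis
  \<comment> \<open>small against \<open>\<tau> j\<close>, so that almost maximality keeps all later directions within \<open>s j\<close> of \<open>U j\<close>\<close>
  define lam where "lam j = min (\<tau> j * (s j)\<^sup>2 / 2) (\<sigma> j / 8)" for j
  have lam: "lam j > 0" "lam j \<le> \<sigma> j / 8" for j using \<tau>[of j] s(1)[of j] \<sigma>[of j] by (auto simp: lam_def)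
  have lamlim: "lam \<longlonglongrightarrow> 0"
  proof (rule tendsto_sandwich[of "\<lambda>_. 0" _ _ "\<lambda>j. \<sigma> j / 8"])
    show "(\<lambda>j. \<sigma> j / 8) \<longlonglongrightarrow> 0" using tendsto_divide[OF \<sigma>lim tendsto_const[of 8]] by simp
  qed (use lam in \<open>auto simp: less_imp_le\<close>)

  define p :: "(nat \<Rightarrow> 'a \<times> 'b \<times> real) \<Rightarrow> nat \<Rightarrow> 'a \<Rightarrow> 'b \<Rightarrow> real"
    where "p f m x u = \<phi> x u - (\<Sum>k<m. \<tau> k * (1 - fst (snd (f k)) \<bullet> u))" for f m x u
  define S :: "(nat \<Rightarrow> 'a \<times> 'b \<times> real) \<Rightarrow> nat \<Rightarrow> ('a \<times> 'b) set"
    where "S f m = {(x, u). (x, u) \<in> D \<and> x \<in> W \<and> (\<forall>j<m. case f j of (y, v, r) \<Rightarrow>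
      x \<in> ball y r \<and> p f j y v \<le> p f m x u \<and>
      (\<forall>t. \<bar>t\<bar> < 1 \<longrightarrow> \<bar>\<Delta> y v t - \<Delta> x v t\<bar> \<le> (\<sigma> j + \<kappa> (p f m x u - p f j y v)) * \<bar>t\<bar>))}" for f m
  define Q :: "(nat \<Rightarrow> 'a \<times> 'b \<times> real) \<Rightarrow> nat \<Rightarrow> 'a \<times> 'b \<times> real \<Rightarrow> bool"
    where "Q f m z = (case z of (x, u, r) \<Rightarrow> (x, u) \<in> S f m \<and> (\<forall>(y, v)\<in>S f m. p f m y v \<le> p f m x u + lam m) \<and>
      0 < r \<and> r \<le> \<sigma> m \<and> cball x r \<subseteq> W \<inter> O' m \<and> (\<forall>j<m. case f j of (y, v, r') \<Rightarrow> cball x r \<subseteq> ball y r'))" for f m z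

  \<comment> \<open>\<open>f j\<close> collects the point, the direction and the radius of stage \<open>j\<close>; each stage depends on all earlier ones\<close>
  have "\<exists>f. \<forall>m. Q f m (f m)"
  proof (rule dependent_wellorder_choice)
    fix z :: "'a \<times> 'b \<times> real" and f g :: "nat \<Rightarrow> 'a \<times> 'b \<times> real" and m :: nat
    assume fg: "\<And>j. j < m \<Longrightarrow> f j = g j"
    have pfg: "p f j = p g j" if "j \<le> m" for j
      using fg that by (intro ext) (auto simp: p_def intro!: sum.cong)
    have "S f m = S g m"
      unfolding S_def using fg pfg by (intro Collect_cong) (auto split: prod.splits)
    then show "Q f m z = Q g m z"
      unfolding Q_def using fg pfg[of m] by (auto split: prod.splits)
  next
    fix m :: nat and f :: "nat \<Rightarrow> 'a \<times> 'b \<times> real"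
    assume IH: "\<And>j. j < m \<Longrightarrow> Q f j (f j)"
    have ne: "S f m \<noteq> {}"
    proof (cases m)
      case 0
      then have "(x0, u0) \<in> S f m" using init by (simp add: S_def)
      then show ?thesis by blast
    next
      case (Suc n)
      obtain x u r where xur: "f n = (x, u, r)" by (cases "f n")
      then have Q: "(x, u) \<in> S f n" "r > 0" using IH[of n] Suc by (auto simp: Q_def)
      then have u: "norm u = 1" by (auto simp: S_def D_def)
      \<comment> \<open>the new penalty vanishes at the pair it is centred at, which therefore stays admissible\<close>
      have pp: "p f (Suc n) x u = p f n x u"
        using u by (simp add: p_def xur norm_eq_1)
      have "(x, u) \<in> S f (Suc n)"
        using Q \<sigma>[of n] unfolding S_def pp
        by (auto simp: less_Suc_eq xur \<kappa>0 pp)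
      then show ?thesis using Suc by blast
    qed
    have le: "p f m y v \<le> B" if "(y, v) \<in> S f m" for y v
    proof -
      have yv: "(y, v) \<in> D" using that by (simp add: S_def)
      have "0 \<le> \<tau> k * (1 - fst (snd (f k)) \<bullet> v)" if "k < m" for k
      proof -
        obtain x u r where xur: "f k = (x, u, r)" by (cases "f k")
        then have "norm u = 1" using IH[OF that] by (auto simp: Q_def S_def D_def)
        then show ?thesis using norm_cauchy_schwarz[of u v] unit[OF yv] \<tau>[of k] xur by simp
      qed
      then have "0 \<le> (\<Sum>k<m. \<tau> k * (1 - fst (snd (f k)) \<bullet> v))" by (intro sum_nonneg) simp
      then have "p f m y v \<le> \<phi> y v" unfolding p_def by simp
      then show ?thesis using \<phi>B[OF yv] by simp
    qed
    have "\<exists>(x, u)\<in>S f m. \<forall>(y, v)\<in>S f m. p f m y v \<le> p f m x u + lam m"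
    proof -
      let ?V = "(\<lambda>(x, u). p f m x u) ` S f m"
      have bdd: "bdd_above ?V" using le by (intro bdd_aboveI2[of _ _ B]) auto
      have "Sup ?V - lam m < Sup ?V" using lam[of m] by simp
      then obtain z where "z \<in> S f m" "Sup ?V - lam m < (\<lambda>(x, u). p f m x u) z"
        using less_cSup_iff[OF _ bdd] ne by auto
      moreover have "p f m y v \<le> Sup ?V" if "(y, v) \<in> S f m" for y v
        using cSup_upper[OF _ bdd, of "p f m y v"] that by force
      ultimately show ?thesis by (intro bexI[of _ z]) (force split: prod.splits)+
    qed
    then obtain x u where xu: "(x, u) \<in> S f m" "\<forall>(y, v)\<in>S f m. p f m y v \<le> p f m x u + lam m" by blast
    define G where "G = W \<inter> O' m \<inter> (\<Inter>j\<in>{..<m}. case f j of (y, v, r') \<Rightarrow> ball y r')"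
    have "open G" unfolding G_def using W O'
      by (intro open_Int open_INT) (auto split: prod.splits)
    moreover have "x \<in> G"
      using xu(1) O'(2) by (auto simp: G_def S_def D_def split: prod.splits)
    ultimately obtain r where "r > 0" "cball x r \<subseteq> G" using open_contains_cball by blast
    then have "min r (\<sigma> m) > 0" "min r (\<sigma> m) \<le> \<sigma> m" "cball x (min r (\<sigma> m)) \<subseteq> G" using \<sigma>[of m] by auto
    moreover from this have "cball x (min r (\<sigma> m)) \<subseteq> ball y r'" if "j < m" "f j = (y, v, r')" for j y v r'
      using that unfolding G_def by (fastforce split: prod.splits)
    ultimately have "Q f m (x, u, min r (\<sigma> m))"
      using xu unfolding Q_def G_def by (auto split: prod.splits)
    then show "\<exists>z. Q f m z" by blast
  qed
  then obtain f where f: "\<And>m. Q f m (f m)" by blast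
  define X where "X k = fst (f k)" for k
  define U where "U k = fst (snd (f k))" for k
  define R where "R k = snd (snd (f k))" for k
  have fk: "f k = (X k, U k, R k)" for k by (simp add: X_def U_def R_def)
  define q where "q m x u = p f m x u" for m x u
  define a where "a m = q m (X m) (U m)" for m
  have q: "q m x u = \<phi> x u - (\<Sum>k<m. \<tau> k * (1 - U k \<bullet> u))" for m x u by (simp add: q_def p_def U_def)
  have S: "(x, u) \<in> S f m \<longleftrightarrow> (x, u) \<in> D \<and> x \<in> W \<and> (\<forall>j<m. x \<in> ball (X j) (R j) \<and> a j \<le> q m x u \<and>
      (\<forall>t. \<bar>t\<bar> < 1 \<longrightarrow> \<bar>\<Delta> (X j) (U j) t - \<Delta> x (U j) t\<bar> \<le> (\<sigma> j + \<kappa> (q m x u - a j)) * \<bar>t\<bar>))" for m x u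
    by (simp add: S_def fk a_def q_def)
  have XS: "(X m, U m) \<in> S f m" and max: "\<And>y v. (y, v) \<in> S f m \<Longrightarrow> q m y v \<le> a m + lam m"
    and R: "0 < R m" "R m \<le> \<sigma> m" "cball (X m) (R m) \<subseteq> W" "cball (X m) (R m) \<subseteq> O' m"
    and RR: "\<And>j. j < m \<Longrightarrow> cball (X m) (R m) \<subseteq> ball (X j) (R j)" for m
    using f[of m] unfolding Q_def case_prod_beta by (auto simp: a_def q_def X_def U_def R_def)
  have XD: "(X m, U m) \<in> D" for m using XS S by blast
  have nU: "norm (U m) = 1" for m using unit[OF XD] .
  have pen: "0 \<le> \<tau> k * (1 - U k \<bullet> u)" if "norm u = 1" for k u
    using norm_cauchy_schwarz[of "U k" u] nU[of k] that \<tau>[of k] by simp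
  have qmono: "q k x u \<le> q m x u" if "m \<le> k" "norm u = 1" for m k x u
  proof -
    have "(\<Sum>k<m. \<tau> k * (1 - U k \<bullet> u)) \<le> (\<Sum>k<k. \<tau> k * (1 - U k \<bullet> u))"
      using that pen by (intro sum_mono2) auto
    then show ?thesis by (simp add: q)
  qed
  have \<kappa>le: "\<kappa> y \<le> \<kappa> z" if "0 \<le> y" "y \<le> z" for y z
    by (rule strict_mono_on_leD[OF \<kappa>mono]) (use that in auto)
  have nested: "(x, u) \<in> S f m" if "m \<le> k" "(x, u) \<in> S f k" for m k x u
  proof -
    have le: "q k x u \<le> q m x u" using that unit S by (intro qmono) blast+
    show ?thesis
      unfolding S
    proof (intro conjI allI impI)
      fix j and t :: real assume j: "j < m" 
      then have *: "a j \<le> q k x u" using that S by auto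
      then show "a j \<le> q m x u" using le by simp
      assume t: "\<bar>t\<bar> < 1"
      have "\<bar>\<Delta> (X j) (U j) t - \<Delta> x (U j) t\<bar> \<le> (\<sigma> j + \<kappa> (q k x u - a j)) * \<bar>t\<bar>"
        using that S j t by auto
      also have "\<dots> \<le> (\<sigma> j + \<kappa> (q m x u - a j)) * \<bar>t\<bar>"
        using * le by (intro mult_right_mono add_left_mono \<kappa>le) auto
      finally show "\<bar>\<Delta> (X j) (U j) t - \<Delta> x (U j) t\<bar> \<le> (\<sigma> j + \<kappa> (q m x u - a j)) * \<bar>t\<bar>" .
    qed (use that S in auto)
  qed
  have qle: "q m (X k) (U k) \<le> a m + lam m" if "m \<le> k" for m k
    using max[OF nested[OF that XS]] .
  have ale: "a m \<le> a k" if "m \<le> k" for m k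
    using XS[of k] that unfolding S a_def by (cases "m = k") auto
  have ale2: "a k \<le> q m (X k) (U k)" if "m \<le> k" for m k
    unfolding a_def using qmono[OF that nU] .
  have close: "norm (u - U m) \<le> s m" if "norm u = 1" "\<tau> m * (1 - U m \<bullet> u) \<le> lam m" for m u
  proof -
    have "\<tau> m * (1 - U m \<bullet> u) \<le> \<tau> m * ((s m)\<^sup>2 / 2)" using that(2) by (simp add: lam_def)
    then have "2 * (1 - U m \<bullet> u) \<le> (s m)\<^sup>2" using \<tau>[of m] by simp
    then have "(norm (u - U m))\<^sup>2 \<le> (s m)\<^sup>2"
      using norm_diff_unit[OF that(1) nU[of m]] by (simp add: inner_commute)
    then show ?thesis using s(1)[of m] by (simp add: abs_le_square_iff[symmetric])
  qed
  \<comment> \<open>later pairs gain at most \<open>lam m\<close> and lose nothing, so the penalty centred at \<open>U m\<close> is at most \<open>lam m\<close>\<close>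
  have Uclose: "norm (U k - U m) \<le> s m" if "m \<le> k" for m k
  proof (cases "m = k")
    case False
    then have "Suc m \<le> k" using that by simp
    have "a m \<le> a k" by (rule ale[OF that])
    also have "\<dots> \<le> q (Suc m) (X k) (U k)" by (rule ale2[OF \<open>Suc m \<le> k\<close>])
    also have "\<dots> = q m (X k) (U k) - \<tau> m * (1 - U m \<bullet> U k)" by (simp add: q)
    finally show ?thesis using qle[OF that] by (intro close nU) simp
  qed (use s(1)[of m] in simp)
  have s\<sigma>: "s m \<le> \<sigma> m" for m
  proof -
    have "\<sigma> m / (8 * (\<mu> + 1)) \<le> \<sigma> m" using \<sigma>(1)[of m] \<mu> by (simp add: divide_le_eq)
    then show ?thesis using s(2)[of m] by simp
  qed
  have cauchy: "Cauchy Y" if "\<And>m k. m \<le> k \<Longrightarrow> dist (Y k) (Y m) \<le> \<sigma> m" for Y :: "nat \<Rightarrow> 'c::metric_space"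
  proof (rule metric_CauchyI)
    fix e :: real assume "e > 0"
    obtain M where M: "\<bar>\<sigma> M\<bar> < e / 2"
      using LIMSEQ_D[OF \<sigma>lim half_gt_zero[OF \<open>e > 0\<close>]] by auto
    have "dist (Y m) (Y k) < e" if "m \<ge> M" "k \<ge> M" for m k
      using \<open>\<And>m k. m \<le> k \<Longrightarrow> dist (Y k) (Y m) \<le> \<sigma> m\<close>[OF that(1)] \<open>\<And>m k. m \<le> k \<Longrightarrow> dist (Y k) (Y m) \<le> \<sigma> m\<close>[OF that(2)]
        M dist_triangle2[of "Y m" "Y k" "Y M"] by linarith
    then show "\<exists>M. \<forall>m\<ge>M. \<forall>k\<ge>M. dist (Y m) (Y k) < e" by blast
  qed
  have Xball: "X k \<in> cball (X m) (R m)" if "m \<le> k" for m k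
  proof (cases "m = k")
    case False
    then have "cball (X k) (R k) \<subseteq> ball (X m) (R m)" using that RR by simp
    moreover have "X k \<in> cball (X k) (R k)" using R(1)[of k] by simp
    ultimately have "X k \<in> ball (X m) (R m)" by (rule subsetD)
    then show ?thesis by simp
  qed (use R(1)[of m] in simp)
  have "Cauchy X"
  proof (rule cauchy)
    show "dist (X k) (X m) \<le> \<sigma> m" if "m \<le> k" for m k
      using Xball[OF that] R(2)[of m] by (simp add: dist_commute)
  qed
  then obtain x\<^sub>s where x\<^sub>s: "X \<longlonglongrightarrow> x\<^sub>s" using Cauchy_convergent convergent_def by blast
  have "Cauchy U"
  proof (rule cauchy)
    show "dist (U k) (U m) \<le> \<sigma> m" if "m \<le> k" for m k
      using Uclose[OF that] s\<sigma>[of m] by (simp add: dist_norm)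
  qed
  then obtain u\<^sub>s where u\<^sub>s: "U \<longlonglongrightarrow> u\<^sub>s" using Cauchy_convergent convergent_def by blast
  have nu: "norm u\<^sub>s = 1"
    using tendsto_norm[OF u\<^sub>s] nU by (simp add: LIMSEQ_const_iff)
  have uU: "norm (u\<^sub>s - U m) \<le> s m" for m
  proof (rule LIMSEQ_le_const2)
    show "(\<lambda>k. norm (U k - U m)) \<longlonglongrightarrow> norm (u\<^sub>s - U m)" using u\<^sub>s by (intro tendsto_intros)
    show "\<exists>N. \<forall>k\<ge>N. norm (U k - U m) \<le> s m" using Uclose by (intro exI[of _ m]) simp
  qed
  have xball: "x\<^sub>s \<in> cball (X m) (R m)" for m
  proof (rule Lim_in_closed_set[OF closed_cball _ _ x\<^sub>s])
    show "\<forall>\<^sub>F k in sequentially. X k \<in> cball (X m) (R m)"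
      using Xball eventually_sequentially by blast
  qed simp
  have xball': "x\<^sub>s \<in> ball (X m) (R m)" for m using xball[of "Suc m"] RR[of m "Suc m"] by auto
  have xN: "x\<^sub>s \<in> N" using xball R(4) O'(2) by blast
  have xW: "x\<^sub>s \<in> W" using xball R(3) by blast
  have "bdd_above (range a)"
  proof (rule bdd_aboveI2)
    show "a k \<le> B" for k
      using \<phi>B[OF XD, of k] qmono[of 0 k "U k" "X k"] nU[of k] by (simp add: a_def q)
  qed
  moreover have "incseq a" using ale by (simp add: incseq_def)
  ultimately obtain a\<^sub>s where a\<^sub>s: "a \<longlonglongrightarrow> a\<^sub>s" "\<And>m. a m \<le> a\<^sub>s"
    using LIMSEQ_incseq_SUP[of a] incseq_le[of a] by blast
  have a\<^sub>sle: "a\<^sub>s \<le> a m + lam m" for m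
    using a\<^sub>s(1) by (rule LIMSEQ_le_const2) (use ale2[of m] qle[of m] order_trans in blast)
  \<comment> \<open>pass to the limit in the admissibility condition of stage \<open>j\<close>\<close>
  have xpoint: "\<bar>\<Delta> (X j) (U j) t - \<Delta> x\<^sub>s (U j) t\<bar> \<le> (\<sigma> j + \<kappa> (a\<^sub>s - a j)) * \<bar>t\<bar>" if t: "\<bar>t\<bar> < 1" for j t
  proof (rule LIMSEQ_le)
    have "((\<lambda>y. \<Delta> y (U j) t) \<longlongrightarrow> \<Delta> x\<^sub>s (U j) t) (nhds x\<^sub>s)"
    proof (rule tendstoI)
      fix e :: real assume "e > 0"
      then have "\<forall>\<^sub>F y in nhds x\<^sub>s. \<forall>t. \<bar>t\<bar> < 1 \<longrightarrow> \<bar>\<Delta> y (U j) t - \<Delta> x\<^sub>s (U j) t\<bar> \<le> e / 2"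
        by (intro point nU) simp
      then show "\<forall>\<^sub>F y in nhds x\<^sub>s. dist (\<Delta> y (U j) t) (\<Delta> x\<^sub>s (U j) t) < e"
        by eventually_elim (use t \<open>e > 0\<close> in \<open>fastforce simp: dist_real_def\<close>)
    qed
    then have "(\<lambda>k. \<Delta> (X k) (U j) t) \<longlonglongrightarrow> \<Delta> x\<^sub>s (U j) t"
      using x\<^sub>s by (rule filterlim_compose)
    then show "(\<lambda>k. \<bar>\<Delta> (X j) (U j) t - \<Delta> (X k) (U j) t\<bar>) \<longlonglongrightarrow> \<bar>\<Delta> (X j) (U j) t - \<Delta> x\<^sub>s (U j) t\<bar>"
      by (intro tendsto_intros)
    have "(\<lambda>k. \<kappa> (a k - a j)) \<longlonglongrightarrow> \<kappa> (a\<^sub>s - a j)"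
    proof (rule continuous_on_tendsto_compose[OF \<kappa>cont])
      show "(\<lambda>k. a k - a j) \<longlonglongrightarrow> a\<^sub>s - a j" using a\<^sub>s(1) by (intro tendsto_intros)
      show "\<forall>\<^sub>F k in sequentially. a k - a j \<in> {0..}"
        using ale[of j] by (auto simp: eventually_sequentially)
    qed (use a\<^sub>s(2) in simp)
    then show "(\<lambda>k. (\<sigma> j + \<kappa> (a k - a j)) * \<bar>t\<bar>) \<longlonglongrightarrow> (\<sigma> j + \<kappa> (a\<^sub>s - a j)) * \<bar>t\<bar>"
      by (intro tendsto_intros)
    show "\<exists>N. \<forall>k\<ge>N. \<bar>\<Delta> (X j) (U j) t - \<Delta> (X k) (U j) t\<bar> \<le> (\<sigma> j + \<kappa> (a k - a j)) * \<bar>t\<bar>"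
      using XS t unfolding S a_def by (intro exI[of _ "Suc j"]) auto
  qed
  have \<kappa>lam: "(\<lambda>j. \<kappa> (lam j)) \<longlonglongrightarrow> 0"
    using continuous_on_tendsto_compose[OF \<kappa>cont lamlim] lam(1) \<kappa>0 by (simp add: less_imp_le)
  obtain d where d: "(\<Delta> x\<^sub>s u\<^sub>s has_real_derivative d) (at 0)" and dlim: "(\<lambda>m. \<phi> (X m) (U m)) \<longlonglongrightarrow> d"
  proof (rule has_real_derivative_of_approximations[of "\<Delta> x\<^sub>s u\<^sub>s" "\<lambda>m. 3 * \<sigma> m + \<kappa> (lam m)" "\<lambda>m. \<phi> (X m) (U m)"])
    show "\<Delta> x\<^sub>s u\<^sub>s 0 = 0" by (rule \<Delta>0[OF nu])
    show "(\<lambda>m. 3 * \<sigma> m + \<kappa> (lam m)) \<longlonglongrightarrow> 0"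
      using tendsto_add[OF tendsto_mult[OF tendsto_const[of 3] \<sigma>lim] \<kappa>lam] by simp
    fix m
    obtain r where "r > 0" and r: "\<And>t. \<bar>t\<bar> < r \<Longrightarrow> \<bar>\<Delta> (X m) (U m) t - \<phi> (X m) (U m) * t\<bar> \<le> \<sigma> m * \<bar>t\<bar>"
      using has_real_derivative_eventually_close[OF \<phi>[OF XD] \<Delta>0[OF nU] \<sigma>(1)[of m], of m] by blast
    have "\<bar>\<Delta> x\<^sub>s u\<^sub>s t - \<phi> (X m) (U m) * t\<bar> \<le> (3 * \<sigma> m + \<kappa> (lam m)) * \<bar>t\<bar>" if t: "\<bar>t\<bar> < min r 1" for t
    proof -
      have 1: "\<bar>\<Delta> x\<^sub>s u\<^sub>s t - \<Delta> x\<^sub>s (U m) t\<bar> \<le> \<sigma> m / 4 * \<bar>t\<bar>"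
        using t by (intro sdir nu nU uU) simp
      have 2: "\<bar>\<Delta> (X m) (U m) t - \<Delta> x\<^sub>s (U m) t\<bar> \<le> (\<sigma> m + \<kappa> (a\<^sub>s - a m)) * \<bar>t\<bar>"
        using t by (intro xpoint) simp
      have 3: "(\<sigma> m + \<kappa> (a\<^sub>s - a m)) * \<bar>t\<bar> \<le> (\<sigma> m + \<kappa> (lam m)) * \<bar>t\<bar>"
        using a\<^sub>s(2)[of m] a\<^sub>sle[of m] by (intro mult_right_mono add_left_mono \<kappa>le) auto
      have 4: "\<bar>\<Delta> (X m) (U m) t - \<phi> (X m) (U m) * t\<bar> \<le> \<sigma> m * \<bar>t\<bar>" using r t by simp
      have "\<bar>\<Delta> x\<^sub>s u\<^sub>s t - \<phi> (X m) (U m) * t\<bar> \<le> \<sigma> m / 4 * \<bar>t\<bar> + (\<sigma> m + \<kappa> (lam m)) * \<bar>t\<bar> + \<sigma> m * \<bar>t\<bar>"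
        using 1 2 3 4 by linarith
      also have "\<dots> \<le> (3 * \<sigma> m + \<kappa> (lam m)) * \<bar>t\<bar>"
        using mult_nonneg_nonneg[of "\<sigma> m" "\<bar>t\<bar>"] \<sigma>(1)[of m] by (simp add: algebra_simps)
      finally show ?thesis .
    qed
    then show "\<forall>\<^sub>F t in at 0. \<bar>\<Delta> x\<^sub>s u\<^sub>s t - \<phi> (X m) (U m) * t\<bar> \<le> (3 * \<sigma> m + \<kappa> (lam m)) * \<bar>t\<bar>"
      using \<open>r > 0\<close> by (auto simp: eventually_at intro!: exI[of _ "min r 1"])
  qed
  have sD: "(x\<^sub>s, u\<^sub>s) \<in> D" using xN nu d by (auto simp: D_def)
  have d\<phi>: "d = \<phi> x\<^sub>s u\<^sub>s" unfolding \<phi>_def using d by (simp add: DERIV_imp_deriv)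
  have qs: "a j \<le> q j x\<^sub>s u\<^sub>s" "q j x\<^sub>s u\<^sub>s \<le> a j + lam j" for j
  proof -
    have lim: "(\<lambda>k. q j (X k) (U k)) \<longlonglongrightarrow> q j x\<^sub>s u\<^sub>s"
      unfolding q using dlim u\<^sub>s by (intro tendsto_intros) (simp_all add: d\<phi>)
    show "a j \<le> q j x\<^sub>s u\<^sub>s"
      by (rule LIMSEQ_le_const[OF lim]) (use ale[of j] ale2[of j] order_trans in blast)
    show "q j x\<^sub>s u\<^sub>s \<le> a j + lam j"
      by (rule LIMSEQ_le_const2[OF lim]) (use qle[of j] in blast)
  qed
  have \<phi>j: "\<bar>\<phi> (X j) (U j) - \<phi> x\<^sub>s u\<^sub>s\<bar> \<le> \<sigma> j / 4" for j
  proof -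
    have "\<bar>(\<Sum>k<j. \<tau> k * (1 - U k \<bullet> u\<^sub>s)) - (\<Sum>k<j. \<tau> k * (1 - U k \<bullet> U j))\<bar> = \<bar>\<Sum>k<j. \<tau> k * (U k \<bullet> (U j - u\<^sub>s))\<bar>"
      by (simp add: sum_subtractf[symmetric] inner_diff_right algebra_simps)
    also have "\<dots> \<le> (\<Sum>k<j. \<tau> k * norm (u\<^sub>s - U j))"
    proof (rule order_trans[OF sum_abs sum_mono])
      fix k show "\<bar>\<tau> k * (U k \<bullet> (U j - u\<^sub>s))\<bar> \<le> \<tau> k * norm (u\<^sub>s - U j)"
        using Cauchy_Schwarz_ineq2[of "U k" "U j - u\<^sub>s"] nU[of k] \<tau>[of k] by (simp add: abs_mult norm_minus_commute)
    qed
    also have "\<dots> \<le> \<mu> * s j"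
      unfolding sum_distrib_right[symmetric] using \<tau>le uU \<mu> by (intro mult_mono) auto
    also have "\<dots> \<le> \<mu> * (\<sigma> j / (8 * (\<mu> + 1)))" using s(2) \<mu> by (intro mult_left_mono) auto
    also have "\<dots> \<le> \<sigma> j / 8" using \<mu> \<sigma>(1)[of j] by (simp add: field_simps)
    finally show ?thesis
      using qs[of j] lam(2)[of j] lam(1)[of j] unfolding a_def q by linarith
  qed
  define L where "L = (\<Sum>k. \<tau> k *\<^sub>R U k)"
  have nsum: "summable (\<lambda>k. norm (\<tau> k *\<^sub>R U k))"
    using sums_summable[OF \<tau>sums] \<tau> nU by (simp add: less_imp_le)
  have Lsums: "(\<lambda>k. \<tau> k *\<^sub>R U k) sums L"
    unfolding L_def using summable_norm_cancel[OF nsum] by (rule summable_sums)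
  have nL: "norm L \<le> \<mu>"
    unfolding L_def using summable_norm[OF nsum] sums_unique[OF \<tau>sums] \<tau> nU by (simp add: less_imp_le)
  have qlim: "(\<lambda>m. q m x u) \<longlonglongrightarrow> \<phi> x u + L \<bullet> u - \<mu>" for x u
  proof -
    have "(\<lambda>k. \<tau> k *\<^sub>R U k \<bullet> u) sums (L \<bullet> u)"
      using bounded_linear.sums[OF bounded_linear_inner_left Lsums] by simp
    then have "(\<lambda>k. \<tau> k * (1 - U k \<bullet> u)) sums (\<mu> - L \<bullet> u)"
      using sums_diff[OF \<tau>sums] by (simp add: algebra_simps)
    then have "(\<lambda>m. \<phi> x u - (\<Sum>k<m. \<tau> k * (1 - U k \<bullet> u))) \<longlonglongrightarrow> \<phi> x u - (\<mu> - L \<bullet> u)"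
      unfolding sums_def by (intro tendsto_intros)
    then show ?thesis by (simp add: q algebra_simps)
  qed
  have qge: "\<phi> x u + L \<bullet> u - \<mu> \<le> q m x u" if "norm u = 1" for m x u
    by (rule LIMSEQ_le_const2[OF qlim]) (use qmono[of m, OF _ that] in blast)
  have hs: "\<phi> x\<^sub>s u\<^sub>s + L \<bullet> u\<^sub>s - \<mu> = a\<^sub>s"
  proof (rule LIMSEQ_unique[OF qlim])
    show "(\<lambda>m. q m x\<^sub>s u\<^sub>s) \<longlonglongrightarrow> a\<^sub>s"
    proof (rule tendsto_sandwich[of a _ _ "\<lambda>m. a m + lam m"])
      show "(\<lambda>m. a m + lam m) \<longlonglongrightarrow> a\<^sub>s" using tendsto_add[OF a\<^sub>s(1) lamlim] by simp
    qed (use qs a\<^sub>s in auto)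
  qed
  have big: "\<phi> x\<^sub>s u\<^sub>s + L \<bullet> u\<^sub>s > \<phi> x0 u0"
  proof -
    have "(x0, u0) \<in> S f 0" using init by (simp add: S)
    then have "\<phi> x0 u0 \<le> a 0 + lam 0" using max[of x0 u0 0] by (simp add: q)
    also have "lam 0 < \<mu>"
    proof -
      have "(s 0)\<^sup>2 \<le> 1" using s(1)[of 0] s\<sigma>[of 0] \<sigma>(2)[of 0] by (intro power_le_one) auto
      then have "\<tau> 0 * (s 0)\<^sup>2 \<le> \<tau> 0 * 1" using \<tau>[of 0] by (intro mult_left_mono) auto
      then have "lam 0 \<le> \<tau> 0 / 2" unfolding lam_def by (intro min.coboundedI1) simp
      then show ?thesis using \<mu> by (simp add: \<tau>_def)
    qed
    finally show ?thesis using hs a\<^sub>s(2)[of 0] by simp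
  qed
  have final: "\<forall>\<^sub>F x in nhds x\<^sub>s. \<forall>u. (x, u) \<in> D \<longrightarrow> \<phi> x u + L \<bullet> u \<ge> \<phi> x\<^sub>s u\<^sub>s + L \<bullet> u\<^sub>s \<longrightarrow>
      (\<forall>t. \<bar>t\<bar> < 1 \<longrightarrow> \<bar>\<Delta> x u\<^sub>s t - \<Delta> x\<^sub>s u\<^sub>s t\<bar>
         \<le> \<kappa> ((\<phi> x u + L \<bullet> u) - (\<phi> x\<^sub>s u\<^sub>s + L \<bullet> u\<^sub>s)) * \<bar>t\<bar>) \<longrightarrow>
      \<phi> x u + L \<bullet> u < \<phi> x\<^sub>s u\<^sub>s + L \<bullet> u\<^sub>s + \<epsilon>" if "\<epsilon> > 0" for \<epsilon>
  proof -
    obtain m where m: "lam m < \<epsilon>"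
      using order_tendstoD(2)[OF lamlim \<open>\<epsilon> > 0\<close>] by (auto simp: eventually_sequentially)
    define h where "h x u = \<phi> x u + L \<bullet> u" for x u
    \<comment> \<open>admissibility at stage \<open>j\<close> for pairs whose slope exceeds the limit slope by \<open>b\<close>\<close>
    define good where "good j x \<longleftrightarrow> x \<in> ball (X j) (R j) \<and> (\<forall>b\<ge>\<epsilon>.
       (\<forall>t. \<bar>t\<bar> < 1 \<longrightarrow> \<bar>\<Delta> x u\<^sub>s t - \<Delta> x\<^sub>s u\<^sub>s t\<bar> \<le> \<kappa> b * \<bar>t\<bar>) \<longrightarrow>
       (\<forall>t. \<bar>t\<bar> < 1 \<longrightarrow> \<bar>\<Delta> (X j) (U j) t - \<Delta> x (U j) t\<bar> \<le> (\<sigma> j + \<kappa> (a\<^sub>s - a j + b)) * \<bar>t\<bar>))" for j x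
    have "\<forall>\<^sub>F x in nhds x\<^sub>s. good j x" for j
    proof -
      define c where "c = a\<^sub>s - a j"
      have c: "c \<ge> 0" using a\<^sub>s(2) by (simp add: c_def)
      have "\<sigma> j / 8 > 0" using \<sigma>(1)[of j] by simp
      obtain r1 where "r1 > 0" and r1: "\<And>t. \<bar>t\<bar> < r1 \<Longrightarrow> \<bar>\<Delta> (X j) (U j) t - \<phi> (X j) (U j) * t\<bar> \<le> \<sigma> j / 8 * \<bar>t\<bar>"
        using has_real_derivative_eventually_close[OF \<phi>[OF XD] \<Delta>0[OF nU] \<open>\<sigma> j / 8 > 0\<close>, of j] by blast
      obtain r2 where "r2 > 0" and r2: "\<And>t. \<bar>t\<bar> < r2 \<Longrightarrow> \<bar>\<Delta> x\<^sub>s u\<^sub>s t - \<phi> x\<^sub>s u\<^sub>s * t\<bar> \<le> \<sigma> j / 8 * \<bar>t\<bar>"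
        using has_real_derivative_eventually_close[OF \<phi>[OF sD] \<Delta>0[OF nu] \<open>\<sigma> j / 8 > 0\<close>] by blast
      define r where "r = min r1 r2"
      have "r > 0" using \<open>r1 > 0\<close> \<open>r2 > 0\<close> by (simp add: r_def)
      have \<kappa>c: "\<kappa> c < \<kappa> (c + \<epsilon>)"
        using c \<open>\<epsilon> > 0\<close> by (intro strict_mono_onD[OF \<kappa>mono]) auto
      \<comment> \<open>the room for error that strict monotonicity leaves at times of modulus at least \<open>r\<close>\<close>
      define e where "e = r * (\<kappa> (c + \<epsilon>) - \<kappa> c)"
      have "e > 0" using \<open>r > 0\<close> \<kappa>c by (simp add: e_def)
      have ev1: "\<forall>\<^sub>F x in nhds x\<^sub>s. x \<in> ball (X j) (R j)"
        using xball'[of j] by (intro eventually_nhds_in_open) auto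
      have ev2: "\<forall>\<^sub>F x in nhds x\<^sub>s. \<forall>t. \<bar>t\<bar> < 1 \<longrightarrow> \<bar>\<Delta> x (U j) t - \<Delta> x\<^sub>s (U j) t\<bar> \<le> e"
        by (rule point[OF nU \<open>e > 0\<close>])
      show ?thesis
        using ev1 ev2
      proof eventually_elim
        case (elim x)
        show ?case
          unfolding good_def
        proof (intro conjI allI impI)
          fix b t :: real assume b: "\<epsilon> \<le> b" and cond: "\<forall>t. \<bar>t\<bar> < 1 \<longrightarrow> \<bar>\<Delta> x u\<^sub>s t - \<Delta> x\<^sub>s u\<^sub>s t\<bar> \<le> \<kappa> b * \<bar>t\<bar>"
            and t: "\<bar>t\<bar> < (1::real)"
          have "\<bar>\<Delta> (X j) (U j) t - \<Delta> x (U j) t\<bar> \<le> (\<sigma> j + \<kappa> (c + b)) * \<bar>t\<bar>"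
          proof (cases "\<bar>t\<bar> < r")
            case True
            have 1: "\<bar>\<Delta> (X j) (U j) t - \<phi> (X j) (U j) * t\<bar> \<le> \<sigma> j / 8 * \<bar>t\<bar>" using r1 True by (simp add: r_def)
            have 2: "\<bar>\<Delta> x\<^sub>s u\<^sub>s t - \<phi> x\<^sub>s u\<^sub>s * t\<bar> \<le> \<sigma> j / 8 * \<bar>t\<bar>" using r2 True by (simp add: r_def)
            have 3: "\<bar>\<phi> (X j) (U j) * t - \<phi> x\<^sub>s u\<^sub>s * t\<bar> \<le> \<sigma> j / 4 * \<bar>t\<bar>"
              using mult_right_mono[OF \<phi>j[of j], of "\<bar>t\<bar>"] by (simp add: abs_mult[symmetric] left_diff_distrib)
            have 4: "\<bar>\<Delta> x u\<^sub>s t - \<Delta> x (U j) t\<bar> \<le> \<sigma> j / 4 * \<bar>t\<bar>"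
              using t by (intro sdir nu nU uU)
            have 5: "\<bar>\<Delta> x u\<^sub>s t - \<Delta> x\<^sub>s u\<^sub>s t\<bar> \<le> \<kappa> b * \<bar>t\<bar>" using cond t by blast
            have 6: "\<kappa> b * \<bar>t\<bar> \<le> \<kappa> (c + b) * \<bar>t\<bar>"
              using b \<open>\<epsilon> > 0\<close> c by (intro mult_right_mono \<kappa>le) auto
            have 7: "0 \<le> \<sigma> j * \<bar>t\<bar>" using \<sigma>(1)[of j] by simp
            have "\<bar>\<Delta> (X j) (U j) t - \<Delta> x (U j) t\<bar> \<le> \<sigma> j * \<bar>t\<bar> + \<kappa> (c + b) * \<bar>t\<bar>"
            proof -
              let ?y = "\<sigma> j * \<bar>t\<bar>"
              have "\<bar>\<Delta> (X j) (U j) t - \<phi> (X j) (U j) * t\<bar> \<le> ?y / 8" "\<bar>\<Delta> x\<^sub>s u\<^sub>s t - \<phi> x\<^sub>s u\<^sub>s * t\<bar> \<le> ?y / 8"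
                "\<bar>\<phi> (X j) (U j) * t - \<phi> x\<^sub>s u\<^sub>s * t\<bar> \<le> ?y / 4" "\<bar>\<Delta> x u\<^sub>s t - \<Delta> x (U j) t\<bar> \<le> ?y / 4"
                using 1 2 3 4 by simp_all
              then show ?thesis using 5 6 7 by linarith
            qed
            then show ?thesis by (simp add: distrib_right)
          next
            case False
            have "\<bar>\<Delta> (X j) (U j) t - \<Delta> x (U j) t\<bar> \<le> (\<sigma> j + \<kappa> c) * \<bar>t\<bar> + e"
              using xpoint[OF t, of j] elim(2) t unfolding c_def by fastforce
            also have "e \<le> \<bar>t\<bar> * (\<kappa> (c + \<epsilon>) - \<kappa> c)"
              unfolding e_def using False \<kappa>c by (intro mult_right_mono) auto
            also have "(\<sigma> j + \<kappa> c) * \<bar>t\<bar> + \<bar>t\<bar> * (\<kappa> (c + \<epsilon>) - \<kappa> c) = (\<sigma> j + \<kappa> (c + \<epsilon>)) * \<bar>t\<bar>"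
              by (simp add: algebra_simps)
            also have "\<dots> \<le> (\<sigma> j + \<kappa> (c + b)) * \<bar>t\<bar>"
              using b \<open>\<epsilon> > 0\<close> c by (intro mult_right_mono add_left_mono \<kappa>le) auto
            finally show ?thesis by simp
          qed
          then show "\<bar>\<Delta> (X j) (U j) t - \<Delta> x (U j) t\<bar> \<le> (\<sigma> j + \<kappa> (a\<^sub>s - a j + b)) * \<bar>t\<bar>" by (simp add: c_def)
        qed (use elim in simp)
      qed
    qed
    then have "\<forall>\<^sub>F x in nhds x\<^sub>s. \<forall>j\<in>{..<m}. good j x" by (intro eventually_ball_finite) auto
    moreover have "\<forall>\<^sub>F x in nhds x\<^sub>s. x \<in> W" using W xW by (rule eventually_nhds_in_open)
    ultimately show ?thesis
    proof eventually_elim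
      case (elim x)
      show ?case
      proof (intro allI impI)
        fix u assume xu: "(x, u) \<in> D"
          and cond: "\<forall>t. \<bar>t\<bar> < 1 \<longrightarrow> \<bar>\<Delta> x u\<^sub>s t - \<Delta> x\<^sub>s u\<^sub>s t\<bar> \<le> \<kappa> ((\<phi> x u + L \<bullet> u) - (\<phi> x\<^sub>s u\<^sub>s + L \<bullet> u\<^sub>s)) * \<bar>t\<bar>"
        define b where "b = (\<phi> x u + L \<bullet> u) - (\<phi> x\<^sub>s u\<^sub>s + L \<bullet> u\<^sub>s)"
        show "\<phi> x u + L \<bullet> u < \<phi> x\<^sub>s u\<^sub>s + L \<bullet> u\<^sub>s + \<epsilon>"
        proof (rule ccontr)
          assume "\<not> ?thesis"
          then have b: "b \<ge> \<epsilon>" by (simp add: b_def)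
          have qb: "a\<^sub>s + b \<le> q m x u" using qge[OF unit[OF xu], of x m] hs by (simp add: b_def)
          have "(x, u) \<in> S f m"
            unfolding S
          proof (intro conjI allI impI xu elim(2))
            fix j and t :: real assume j: "j < m"
            have g: "good j x" using elim(1) j by simp
            then show "x \<in> ball (X j) (R j)" by (simp add: good_def)
            show "a j \<le> q m x u" using qb b \<open>\<epsilon> > 0\<close> a\<^sub>s(2)[of j] by linarith
            assume t: "\<bar>t\<bar> < (1::real)"
            have "\<bar>\<Delta> (X j) (U j) t - \<Delta> x (U j) t\<bar> \<le> (\<sigma> j + \<kappa> (a\<^sub>s - a j + b)) * \<bar>t\<bar>"
              using g cond b t unfolding good_def b_def by blast
            also have "\<dots> \<le> (\<sigma> j + \<kappa> (q m x u - a j)) * \<bar>t\<bar>"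
              using qb b \<open>\<epsilon> > 0\<close> a\<^sub>s(2)[of j] by (intro mult_right_mono add_left_mono \<kappa>le) auto
            finally show "\<bar>\<Delta> (X j) (U j) t - \<Delta> x (U j) t\<bar> \<le> (\<sigma> j + \<kappa> (q m x u - a j)) * \<bar>t\<bar>" .
          qed
          then have "q m x u \<le> a m + lam m" by (rule max)
          then show False using qb b m a\<^sub>s(2)[of m] by linarith
        qed
      qed
    qed
  qed
  show thesis
    using final by (intro that[OF nL sD xW big] allI impI)
qed

section \<open>Increments of Lipschitz functions on the Heisenberg group\<close>

lemma norm_heis_le: "norm (x :: 'n::finite heis) \<le> norm (hproj x) + \<bar>snd (snd x)\<bar>"
proof -
  obtain a b c where x: "x = (a, b, c)" by (cases x)
  have "norm x \<le> norm (a, b, 0::real) + norm (0::(real, 'n) vec, 0::(real, 'n) vec, c)"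
    using norm_triangle_ineq[of "(a, b, 0::real)" "(0, 0, c)"] by (simp add: x)
  then show ?thesis by (simp add: x norm_Pair)
qed

text \<open>
  Small balls of the Carnot-Caratheodory distance lie in Euclidean neighbourhoods, since the distance
  dominates the horizontal displacement and the square root of the vertical gap.
\<close>

lemma eventually_nhds_ccdist:
  fixes p :: "'n::finite heis"
  assumes "\<forall>\<^sub>F x in nhds p. P x"
  shows "\<exists>\<delta>>0. \<forall>x. ccdist x p \<le> \<delta> \<longrightarrow> P x"
proof -
  obtain d where "d > 0" and d: "\<And>x. dist x p < d \<Longrightarrow> P x"
    using assms unfolding eventually_nhds_metric by blast
  define M where "M = 3 + 2 * norm (hproj p)"
  have "M > 0" unfolding M_def by (intro add_pos_nonneg) simp_all
  define \<delta> where "\<delta> = min 1 (d / (2 * M))"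
  have "\<delta> > 0" "\<delta> \<le> 1" "\<delta> * M < d" 
    using \<open>d > 0\<close> \<open>M > 0\<close> by (auto simp: \<delta>_def min_def field_simps)
  have "P x" if x: "ccdist x p \<le> \<delta>" for x
  proof -
    have h: "norm (hproj x - hproj p) \<le> \<delta>"
      using ccdist_lower(1)[of p x] x by (simp add: norm_minus_commute)
    have "(ccdist x p)\<^sup>2 \<le> \<delta>\<^sup>2" using x ccdist_nonneg by (intro power_mono)
    also have "\<delta>\<^sup>2 \<le> \<delta>" using \<open>\<delta> > 0\<close> \<open>\<delta> \<le> 1\<close> by (simp add: power2_eq_square mult_left_le)
    finally have v: "\<bar>vgap x p\<bar> \<le> 2 * \<delta>" using vgap_le_ccdist[of x p] by simp
    have "\<bar>symplectic (hproj x - hproj p) (hproj p)\<bar> \<le> \<delta> * norm (hproj p)"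
      using h by (intro order_trans[OF symplectic_le] mult_right_mono) auto
    moreover have "snd (snd x) - snd (snd p) = 2 * symplectic (hproj x - hproj p) (hproj p) - vgap x p"
      by (simp add: vgap_def symplectic.diff_left)
    ultimately have "\<bar>snd (snd x) - snd (snd p)\<bar> \<le> 2 * (\<delta> * norm (hproj p)) + 2 * \<delta>" using v by linarith
    then have "dist x p \<le> \<delta> * M"
      using norm_heis_le[of "x - p"] h by (simp add: dist_norm M_def algebra_simps)
    then show "P x" using d \<open>\<delta> * M < d\<close> by simp
  qed
  then show ?thesis using \<open>\<delta> > 0\<close> by blast
qed

lemma continuous_on_ccdist_bound:
  "continuous_on UNIV (\<lambda>y. norm (hproj y - hproj x))" "continuous_on UNIV (vgap x)"
  unfolding vgap_def hproj_def by (intro continuous_intros symplectic.continuous_on)+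

definition increment :: "('n::finite heis \<Rightarrow> real) \<Rightarrow> 'n heis \<Rightarrow> (real, 'n) vec \<times> (real, 'n) vec \<Rightarrow> real \<Rightarrow> real" where
  "increment f x u t = f (x + t *\<^sub>R hfield u x) - f x"

lemma increment_bounded:
  assumes C: "\<forall>x y. \<bar>f x - f y\<bar> \<le> C * (norm (hproj y - hproj x) + 380 * sqrt \<bar>vgap x y\<bar>)"
    and "norm u = 1"
  shows "\<bar>increment f x u t\<bar> \<le> C * \<bar>t\<bar>"
proof -
  have "\<bar>increment f x u t\<bar> = \<bar>f x - f (x + t *\<^sub>R hfield u x)\<bar>"
    by (simp add: increment_def abs_minus_commute)
  also have "\<dots> \<le> C * (norm (hproj (x + t *\<^sub>R hfield u x) - hproj x) + 380 * sqrt \<bar>vgap x (x + t *\<^sub>R hfield u x)\<bar>)"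
    using C by blast
  also have "\<dots> = C * \<bar>t\<bar>" using assms(2) by (simp add: vgap_flow_right symplectic.zero_right)
  finally show ?thesis .
qed

text \<open>
  After time \<open>t\<close> the lines from \<open>x\<close> in directions \<open>u\<close> and \<open>v\<close> have vertical gap
  \<open>2 * t\<^sup>2 * symplectic u v\<close>. The form vanishes on the diagonal, so this is of order
  \<open>t\<^sup>2 * norm (u - v)\<close>, and its square root is linear in \<open>t\<close>.
\<close>

lemma increment_direction:
  assumes C: "\<forall>x y. \<bar>f x - f y\<bar> \<le> C * (norm (hproj y - hproj x) + 380 * sqrt \<bar>vgap x y\<bar>)" "C > 0"
    and "e > 0"
  shows "\<exists>s>0. \<forall>x u v t. norm u = 1 \<and> norm v = 1 \<and> norm (u - v) \<le> s \<and> \<bar>t\<bar> < 1 \<longrightarrow>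
      \<bar>increment f x u t - increment f x v t\<bar> \<le> e * \<bar>t\<bar>"
proof -
  define s where "s = min (e / (2 * C)) ((e / (760 * C))\<^sup>2 / 2)"
  have "s > 0" using \<open>C > 0\<close> \<open>e > 0\<close> by (simp add: s_def)
  moreover have "\<bar>increment f x u t - increment f x v t\<bar> \<le> e * \<bar>t\<bar>"
    if u: "norm u = 1" and uv: "norm (u - v) \<le> s" for x u v t
  proof -
    have "symplectic u v = symplectic u (v - u)" by (simp add: symplectic.diff_right)
    then have "\<bar>symplectic u v\<bar> \<le> s"
      using symplectic_le[of u "v - u"] u uv by (simp add: norm_minus_commute)
    then have "2 * \<bar>symplectic u v\<bar> \<le> (e / (760 * C))\<^sup>2" by (simp add: s_def)
    then have "\<bar>2 * t * t * symplectic u v\<bar> \<le> (e / (760 * C))\<^sup>2 * t\<^sup>2"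
      using mult_right_mono[of "2 * \<bar>symplectic u v\<bar>" "(e / (760 * C))\<^sup>2" "t\<^sup>2"]
      by (simp add: abs_mult power2_eq_square mult_ac)
    then have "sqrt \<bar>2 * t * t * symplectic u v\<bar> \<le> sqrt ((e / (760 * C))\<^sup>2 * t\<^sup>2)" by (rule real_sqrt_le_mono)
    also have "\<dots> = e / (760 * C) * \<bar>t\<bar>" using \<open>C > 0\<close> \<open>e > 0\<close> by (simp add: real_sqrt_mult)
    finally have 1: "sqrt \<bar>vgap (x + t *\<^sub>R hfield u x) (x + t *\<^sub>R hfield v x)\<bar> \<le> e / (760 * C) * \<bar>t\<bar>"
      by (simp add: vgap_flow_directions)
    have "norm (hproj (x + t *\<^sub>R hfield v x) - hproj (x + t *\<^sub>R hfield u x)) = \<bar>t\<bar> * norm (u - v)"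
      by (simp add: scaleR_diff_right[symmetric] norm_minus_commute del: scaleR_diff_right)
    also have "\<dots> \<le> \<bar>t\<bar> * (e / (2 * C))"
      using uv by (intro mult_left_mono) (auto simp: s_def)
    finally have 2: "norm (hproj (x + t *\<^sub>R hfield v x) - hproj (x + t *\<^sub>R hfield u x)) \<le> \<bar>t\<bar> * (e / (2 * C))" .
    have "\<bar>increment f x u t - increment f x v t\<bar> = \<bar>f (x + t *\<^sub>R hfield u x) - f (x + t *\<^sub>R hfield v x)\<bar>"
      by (simp add: increment_def)
    also have "\<dots> \<le> C * (norm (hproj (x + t *\<^sub>R hfield v x) - hproj (x + t *\<^sub>R hfield u x)) +
        380 * sqrt \<bar>vgap (x + t *\<^sub>R hfield u x) (x + t *\<^sub>R hfield v x)\<bar>)"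
      using C(1) by blast
    also have "\<dots> \<le> C * (\<bar>t\<bar> * (e / (2 * C)) + 380 * (e / (760 * C) * \<bar>t\<bar>))"
      using 1 2 \<open>C > 0\<close> by (intro mult_left_mono add_mono) auto
    also have "\<dots> = e * \<bar>t\<bar>" using \<open>C > 0\<close> by (simp add: field_simps)
    finally show ?thesis .
  qed
  ultimately show ?thesis by blast
qed

text \<open>
  Lines in the same direction from \<open>x\<close> and \<open>y\<close> drift apart vertically, by
  \<open>4 * t * symplectic u (hproj y - hproj x)\<close>; for bounded \<open>t\<close> this tends to \<open>0\<close> as \<open>y\<close> tends to \<open>x\<close>.
\<close>

lemma increment_point:
  assumes C: "\<forall>x y. \<bar>f x - f y\<bar> \<le> C * (norm (hproj y - hproj x) + 380 * sqrt \<bar>vgap x y\<bar>)" "C > 0"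
    and u: "norm u = 1" and "e > 0"
  shows "\<forall>\<^sub>F y in nhds x. \<forall>t. \<bar>t\<bar> < 1 \<longrightarrow> \<bar>increment f y u t - increment f x u t\<bar> \<le> e"
proof -
  define g where "g y = C * (norm (hproj y - hproj x) + 380 * sqrt (\<bar>vgap x y\<bar> + 4 * norm (hproj y - hproj x)))
     + C * (norm (hproj y - hproj x) + 380 * sqrt \<bar>vgap x y\<bar>)" for y
  have "continuous_on UNIV g"
    unfolding g_def by (intro continuous_intros continuous_on_ccdist_bound)
  then have "isCont g x" by (rule continuous_on_interior) simp
  then have "(g \<longlongrightarrow> g x) (nhds x)" by (simp add: isCont_def tendsto_at_iff_tendsto_nhds)
  moreover have "g x = 0" by (simp add: g_def)
  ultimately have "\<forall>\<^sub>F y in nhds x. g y < e" using \<open>e > 0\<close> by (auto dest: order_tendstoD(2))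
  then show ?thesis
  proof eventually_elim
    case (elim y)
    show ?case
    proof (intro allI impI)
      fix t :: real assume t: "\<bar>t\<bar> < 1"
      have "\<bar>symplectic u (hproj y - hproj x)\<bar> \<le> norm (hproj y - hproj x)"
        using symplectic_le[of u "hproj y - hproj x"] u by simp
      then have "\<bar>t\<bar> * \<bar>symplectic u (hproj y - hproj x)\<bar> \<le> 1 * norm (hproj y - hproj x)"
        using t by (intro mult_mono) auto
      then have "\<bar>4 * t * symplectic u (hproj y - hproj x)\<bar> \<le> 4 * norm (hproj y - hproj x)"
        by (simp add: abs_mult)
      then have "\<bar>vgap (x + t *\<^sub>R hfield u x) (y + t *\<^sub>R hfield u y)\<bar> \<le> \<bar>vgap x y\<bar> + 4 * norm (hproj y - hproj x)"
        unfolding vgap_flow_points by linarith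
      then have 1: "sqrt \<bar>vgap (x + t *\<^sub>R hfield u x) (y + t *\<^sub>R hfield u y)\<bar> \<le> sqrt (\<bar>vgap x y\<bar> + 4 * norm (hproj y - hproj x))"
        by (rule real_sqrt_le_mono)
      have "\<bar>f (x + t *\<^sub>R hfield u x) - f (y + t *\<^sub>R hfield u y)\<bar> \<le>
         C * (norm (hproj (y + t *\<^sub>R hfield u y) - hproj (x + t *\<^sub>R hfield u x)) +
           380 * sqrt \<bar>vgap (x + t *\<^sub>R hfield u x) (y + t *\<^sub>R hfield u y)\<bar>)"
        using C(1) by blast
      also have "\<dots> \<le> C * (norm (hproj y - hproj x) + 380 * sqrt (\<bar>vgap x y\<bar> + 4 * norm (hproj y - hproj x)))"
        using 1 \<open>C > 0\<close> by (intro mult_left_mono add_mono) auto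
      finally have 2: "\<bar>f (x + t *\<^sub>R hfield u x) - f (y + t *\<^sub>R hfield u y)\<bar> \<le> \<dots>" .
      have 3: "\<bar>f x - f y\<bar> \<le> C * (norm (hproj y - hproj x) + 380 * sqrt \<bar>vgap x y\<bar>)" using C(1) by blast
      show "\<bar>increment f y u t - increment f x u t\<bar> \<le> e"
        using 2 3 elim unfolding increment_def g_def by linarith
    qed
  qed
qed

lemma linear_functional_le_ccdist: "\<bar>L \<bullet> hproj x - L \<bullet> hproj y\<bar> \<le> norm L * ccdist x y"
proof -
  have "\<bar>L \<bullet> (hproj x - hproj y)\<bar> \<le> norm L * norm (hproj x - hproj y)"
    by (rule Cauchy_Schwarz_ineq2)
  also have "\<dots> \<le> norm L * ccdist x y"
    using ccdist_lower(1)[of y x] by (intro mult_left_mono) (simp_all add: norm_minus_commute)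
  finally show ?thesis by (simp add: inner_diff_right)
qed

lemma Lipschitz_fun_add_linear:
  assumes "Lipschitz_fun f"
  shows "Lipschitz_fun (\<lambda>x. f x + L \<bullet> hproj x)"
proof -
  obtain C where "C \<ge> 0" and C: "\<And>x y. \<bar>f x - f y\<bar> \<le> C * ccdist x y"
    using assms unfolding Lipschitz_fun_def by blast
  have "\<bar>(f x + L \<bullet> hproj x) - (f y + L \<bullet> hproj y)\<bar> \<le> (C + norm L) * ccdist x y" for x y
    using C[of x y] linear_functional_le_ccdist[of L x y] by (simp add: algebra_simps)
  then show ?thesis
    unfolding Lipschitz_fun_def using \<open>C \<ge> 0\<close> by (intro exI[of _ "C + norm L"]) auto
qed

lemma H_linear_inner_hproj: "H_linear (\<lambda>x. L \<bullet> hproj x)"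
  unfolding H_linear_def
proof (intro conjI allI impI)
  show "L \<bullet> hproj (hmult x y) = L \<bullet> hproj x + L \<bullet> hproj y" for x y
  proof -
    have "hproj (hmult x y) = hproj x + hproj y" by (cases x; cases y) simp
    then show ?thesis by (simp add: inner_add_right)
  qed
  show "L \<bullet> hproj (hdil r x) = r * (L \<bullet> hproj x)" for r x
  proof -
    have "hproj (hdil r x) = r *\<^sub>R hproj x" by (cases x) simp
    then show ?thesis by simp
  qed
qed

text \<open>
  Along a horizontal line the linear function contributes exactly \<open>t * (L \<bullet> u)\<close>; so it shifts horizontal
  derivatives by \<open>L \<bullet> u\<close> and does not affect their existence.
\<close>

lemma has_hderiv_add_linear_iff:
  assumes "Lipschitz_fun f"
  shows "has_hderiv (\<lambda>x. f x + L \<bullet> hproj x) (hfield u) x d \<longleftrightarrow>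
    (increment f x u has_real_derivative (d - L \<bullet> u)) (at 0)"
proof -
  let ?g = "\<lambda>s. f (x + s *\<^sub>R hfield u x) + L \<bullet> hproj (x + s *\<^sub>R hfield u x)"
  let ?l = "\<lambda>s. f x + L \<bullet> hproj x + s * (L \<bullet> u)"
  have l: "(?l has_real_derivative (L \<bullet> u)) (at 0)"
    by (auto intro!: derivative_eq_intros)
  have g: "?g = (\<lambda>s. increment f x u s + ?l s)"
    by (simp add: increment_def inner_add_right)
  have "(?g has_real_derivative d) (at 0) \<longleftrightarrow> (increment f x u has_real_derivative (d - L \<bullet> u)) (at 0)"
  proof
    assume "(?g has_real_derivative d) (at 0)"
    moreover have "increment f x u = (\<lambda>s. ?g s - ?l s)" by (simp add: increment_def[abs_def] inner_add_right)
    ultimately show "(increment f x u has_real_derivative (d - L \<bullet> u)) (at 0)"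
      using DERIV_diff[OF _ l] by simp
  next
    assume "(increment f x u has_real_derivative (d - L \<bullet> u)) (at 0)"
    from DERIV_add[OF this l] show "(?g has_real_derivative d) (at 0)"
      unfolding g by simp
  qed
  then show ?thesis
    using has_hderiv_iff[OF Lipschitz_fun_add_linear[OF assms], of L u x d] by simp
qed

section \<open>An almost locally maximal horizontal derivative\<close>

theorem proposition6p1:
  fixes N :: "'n::finite heis set"
    and f0 :: "'n heis \<Rightarrow> real"
    and x0 :: "'n heis"
    and E0 :: "'n heis \<Rightarrow> 'n heis"
    and \<delta>0 \<mu> K :: real
  assumes "negligible N"
    and "gdelta N"
    and "contains_rational_horizontal_lines N"
    and "Lipschitz_fun f0"
    and "(x0, E0) \<in> D_set N f0"
    and "\<delta>0 > 0" and "\<mu> > 0" and "K > 0"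
  shows "\<exists>f :: 'n heis \<Rightarrow> real.
    Lipschitz_fun f \<and>
    H_linear (\<lambda>x. f x - f0 x) \<and>
    Lip_H (\<lambda>x. f x - f0 x) \<le> \<mu> \<and>
    (\<exists>xs Es. (xs, Es) \<in> D_set N f \<and>
      ccdist xs x0 \<le> \<delta>0 \<and>
      hderiv f Es xs > 0 \<and>
      (\<forall>\<epsilon>>0. \<exists>\<delta>>0. \<forall>x E. (x, E) \<in> D_set N f \<longrightarrow>
        ccdist x xs \<le> \<delta> \<and> hderiv f E x \<ge> hderiv f Es xs \<longrightarrow>
        (\<forall>t\<in>{-1<..<1}.
          \<bar>(f (x + t *\<^sub>R Es x) - f x) - (f (xs + t *\<^sub>R Es xs) - f xs)\<bar>
            \<le> K * \<bar>t\<bar> * (hderiv f E x - hderiv f Es xs) powr (1/4)) \<longrightarrow>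
        hderiv f E x < hderiv f Es xs + \<epsilon>))"
proof -
  note lip = \<open>Lipschitz_fun f0\<close>
  obtain C where "C > 0" and C: "\<forall>x y. \<bar>f0 x - f0 y\<bar> \<le> C * (norm (hproj y - hproj x) + 380 * sqrt \<bar>vgap x y\<bar>)"
    using Lipschitz_fun_coordinates[OF lip] by blast
  define \<phi> where "\<phi> x u = deriv (increment f0 x u) 0" for x u
  define D where "D = {(x, u). x \<in> N \<and> norm u = 1 \<and> (\<exists>d. (increment f0 x u has_real_derivative d) (at 0))}"
  have D_set: "(x, E) \<in> D_set N (\<lambda>x. f0 x + L \<bullet> hproj x) \<longleftrightarrow> (\<exists>u. E = hfield u \<and> (x, u) \<in> D)" for x E L
  proof -
    have "(\<exists>d. has_hderiv (\<lambda>x. f0 x + L \<bullet> hproj x) (hfield u) x d) \<longleftrightarrow>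
      (\<exists>d. (increment f0 x u has_real_derivative d) (at 0))" for u
      unfolding has_hderiv_add_linear_iff[OF lip] by (metis add_diff_cancel_right')
    moreover have "(x, E) \<in> D_set N (\<lambda>x. f0 x + L \<bullet> hproj x) \<longleftrightarrow> (\<exists>u. E = hfield u \<and> x \<in> N \<and> norm u = 1 \<and>
        (\<exists>d. has_hderiv (\<lambda>x. f0 x + L \<bullet> hproj x) (hfield u) x d))"
      unfolding D_set_def V_fields_def omega_def image_def by (auto simp only: mem_Collect_eq case_prod_conv hcoeffs_hfield UNIV_I bex_UNIV)
    ultimately show ?thesis unfolding D_def by simp
  qed
  have hderiv: "hderiv (\<lambda>x. f0 x + L \<bullet> hproj x) (hfield u) x = \<phi> x u + L \<bullet> u" if xu: "(x, u) \<in> D" for x u L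
    unfolding hderiv_def
  proof (rule the_equality)
    obtain d where d: "(increment f0 x u has_real_derivative d) (at 0)" using xu by (auto simp: D_def)
    then have \<phi>: "(increment f0 x u has_real_derivative \<phi> x u) (at 0)"
      by (simp add: \<phi>_def DERIV_imp_deriv)
    then show "has_hderiv (\<lambda>x. f0 x + L \<bullet> hproj x) (hfield u) x (\<phi> x u + L \<bullet> u)"
      unfolding has_hderiv_add_linear_iff[OF lip] by simp
    fix d assume "has_hderiv (\<lambda>x. f0 x + L \<bullet> hproj x) (hfield u) x d"
    then show "d = \<phi> x u + L \<bullet> u"
      unfolding has_hderiv_add_linear_iff[OF lip] using DERIV_unique[OF \<phi>] by force
  qed
  obtain u0 where u0: "(x0, u0) \<in> D"
    using \<open>(x0, E0) \<in> D_set N f0\<close> D_set[of x0 E0 0] by auto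
  \<comment> \<open>reversing the direction if necessary makes the initial derivative nonnegative\<close>
  obtain u1 where u1: "(x0, u1) \<in> D" "\<phi> x0 u1 \<ge> 0"
  proof (cases "\<phi> x0 u0 \<ge> 0")
    case True
    then show ?thesis using u0 that by blast
  next
    case False
    have "(increment f0 x0 u0 has_real_derivative \<phi> x0 u0) (at 0)"
      using u0 by (auto simp: D_def \<phi>_def DERIV_imp_deriv)
    then have "((\<lambda>t. increment f0 x0 u0 (- t)) has_real_derivative (- \<phi> x0 u0)) (at 0)"
      using DERIV_mirror[of "increment f0 x0 u0" "\<phi> x0 u0" 0] by simp
    moreover have "(\<lambda>t. increment f0 x0 u0 (- t)) = increment f0 x0 (- u0)"
      by (auto simp: increment_def hfield_eq symplectic.minus_left)
    ultimately have "(increment f0 x0 (- u0) has_real_derivative (- \<phi> x0 u0)) (at 0)" by simp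
    then have "(x0, - u0) \<in> D" "\<phi> x0 (- u0) = - \<phi> x0 u0"
      using u0 by (auto simp: D_def \<phi>_def DERIV_imp_deriv)
    then show ?thesis using False by (intro that[of "- u0"]) simp_all
  qed
  \<comment> \<open>by the upper bound for the distance, \<open>W\<close> lies in the ball of radius \<open>\<delta>0\<close>\<close>
  define W where "W = {x. norm (hproj x0 - hproj x) + 380 * sqrt \<bar>vgap x x0\<bar> < \<delta>0}"
  have "open W"
  proof -
    have "continuous_on UNIV (\<lambda>x. norm (hproj x - hproj x0) + 380 * sqrt \<bar>vgap x0 x\<bar>)"
      by (intro continuous_intros continuous_on_ccdist_bound)
    then show ?thesis
      unfolding W_def vgap_swap[of _ x0] norm_minus_commute[of "hproj x0"]
      by (simp add: open_Collect_less continuous_on_const)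
  qed
  have "x0 \<in> W" using \<open>\<delta>0 > 0\<close> by (simp add: W_def)
  define \<kappa> where "\<kappa> s = K * s powr (1/4)" for s :: real
  have \<kappa>: "continuous_on {0..} \<kappa>" "strict_mono_on {0..} \<kappa>" "\<kappa> 0 = 0"
  proof -
    show "continuous_on {0..} \<kappa>"
      unfolding \<kappa>_def by (intro continuous_intros continuous_on_powr') auto
    show "strict_mono_on {0..} \<kappa>"
      unfolding \<kappa>_def using \<open>K > 0\<close>
      by (intro strict_mono_onI mult_strict_left_mono powr_less_mono2) auto
  qed (simp add: \<kappa>_def)
  obtain L xs us where L: "norm L \<le> \<mu>" and xsD: "(xs, us) \<in> D" and xsW: "xs \<in> W"
    and big: "\<phi> xs us + L \<bullet> us > \<phi> x0 u1"
    and max: "\<forall>\<epsilon>>0. \<forall>\<^sub>F x in nhds xs. \<forall>u. (x, u) \<in> D \<longrightarrow> \<phi> x u + L \<bullet> u \<ge> \<phi> xs us + L \<bullet> us \<longrightarrow>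
      (\<forall>t. \<bar>t\<bar> < 1 \<longrightarrow> \<bar>increment f0 x us t - increment f0 xs us t\<bar>
         \<le> \<kappa> ((\<phi> x u + L \<bullet> u) - (\<phi> xs us + L \<bullet> us)) * \<bar>t\<bar>) \<longrightarrow>
      \<phi> x u + L \<bullet> u < \<phi> xs us + L \<bullet> us + \<epsilon>"
    by (rule almost_locally_maximal_direction[OF \<open>gdelta N\<close> \<open>open W\<close> \<open>\<mu> > 0\<close>
          increment_bounded[OF C] increment_direction[OF C \<open>C > 0\<close>] increment_point[OF C \<open>C > 0\<close>]
          \<kappa> u1(1)[unfolded D_def] \<open>x0 \<in> W\<close>, folded D_def \<phi>_def])
  define f where "f x = f0 x + L \<bullet> hproj x" for x
  have ff0: "(\<lambda>x. f x - f0 x) = (\<lambda>x. L \<bullet> hproj x)" by (simp add: f_def)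
  have Df: "(x, E) \<in> D_set N f \<longleftrightarrow> (\<exists>u. E = hfield u \<and> (x, u) \<in> D)" for x E
    using D_set[of x E L] by (simp add: f_def[abs_def])
  have hf: "hderiv f (hfield u) x = \<phi> x u + L \<bullet> u" if "(x, u) \<in> D" for x u
    using hderiv[OF that, of L] by (simp add: f_def[abs_def])
  show ?thesis
  proof (intro exI[of _ f] conjI)
    show "Lipschitz_fun f" unfolding f_def[abs_def] by (rule Lipschitz_fun_add_linear[OF lip])
    show "H_linear (\<lambda>x. f x - f0 x)" unfolding ff0 by (rule H_linear_inner_hproj)
    have "Lip_H (\<lambda>x. f x - f0 x) \<le> norm L"
      unfolding ff0 Lip_H_def
    proof (rule cInf_lower)
      show "norm L \<in> {C. 0 \<le> C \<and> (\<forall>x y. \<bar>L \<bullet> hproj x - L \<bullet> hproj y\<bar> \<le> C * ccdist x y)}"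
        by (intro CollectI conjI allI linear_functional_le_ccdist) simp
    qed (auto intro: bdd_belowI[of _ 0])
    then show "Lip_H (\<lambda>x. f x - f0 x) \<le> \<mu>" using L by simp
    show "\<exists>xs Es. (xs, Es) \<in> D_set N f \<and> ccdist xs x0 \<le> \<delta>0 \<and> hderiv f Es xs > 0 \<and>
      (\<forall>\<epsilon>>0. \<exists>\<delta>>0. \<forall>x E. (x, E) \<in> D_set N f \<longrightarrow>
        ccdist x xs \<le> \<delta> \<and> hderiv f E x \<ge> hderiv f Es xs \<longrightarrow>
        (\<forall>t\<in>{-1<..<1}. \<bar>(f (x + t *\<^sub>R Es x) - f x) - (f (xs + t *\<^sub>R Es xs) - f xs)\<bar>
            \<le> K * \<bar>t\<bar> * (hderiv f E x - hderiv f Es xs) powr (1/4)) \<longrightarrow>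
        hderiv f E x < hderiv f Es xs + \<epsilon>)"
    proof (intro exI[of _ xs] exI[of _ "hfield us"] conjI allI impI)
      show "(xs, hfield us) \<in> D_set N f" using Df xsD by blast
      show "ccdist xs x0 \<le> \<delta>0"
        using ccdist_le_coordinates[of xs x0] xsW by (simp add: W_def)
      show "hderiv f (hfield us) xs > 0" using hf[OF xsD] big u1(2) by simp
      fix \<epsilon> :: real assume "\<epsilon> > 0"
      obtain \<delta> where "\<delta> > 0" and \<delta>: "\<forall>x. ccdist x xs \<le> \<delta> \<longrightarrow> (\<forall>u. (x, u) \<in> D \<longrightarrow> \<phi> x u + L \<bullet> u \<ge> \<phi> xs us + L \<bullet> us \<longrightarrow>
          (\<forall>t. \<bar>t\<bar> < 1 \<longrightarrow> \<bar>increment f0 x us t - increment f0 xs us t\<bar>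
             \<le> \<kappa> ((\<phi> x u + L \<bullet> u) - (\<phi> xs us + L \<bullet> us)) * \<bar>t\<bar>) \<longrightarrow>
          \<phi> x u + L \<bullet> u < \<phi> xs us + L \<bullet> us + \<epsilon>)"
        using eventually_nhds_ccdist[OF max[rule_format, OF \<open>\<epsilon> > 0\<close>]] by blast
      show "\<exists>\<delta>>0. \<forall>x E. (x, E) \<in> D_set N f \<longrightarrow>
        ccdist x xs \<le> \<delta> \<and> hderiv f E x \<ge> hderiv f (hfield us) xs \<longrightarrow>
        (\<forall>t\<in>{-1<..<1}. \<bar>(f (x + t *\<^sub>R hfield us x) - f x) - (f (xs + t *\<^sub>R hfield us xs) - f xs)\<bar>
            \<le> K * \<bar>t\<bar> * (hderiv f E x - hderiv f (hfield us) xs) powr (1/4)) \<longrightarrow>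
        hderiv f E x < hderiv f (hfield us) xs + \<epsilon>"
      proof (intro exI[of _ \<delta>] conjI allI impI \<open>\<delta> > 0\<close>)
        fix x E assume "(x, E) \<in> D_set N f"
        then obtain u where E: "E = hfield u" and xu: "(x, u) \<in> D" using Df by blast
        assume 1: "ccdist x xs \<le> \<delta> \<and> hderiv f E x \<ge> hderiv f (hfield us) xs"
        assume 2: "\<forall>t\<in>{-1<..<1}. \<bar>(f (x + t *\<^sub>R hfield us x) - f x) - (f (xs + t *\<^sub>R hfield us xs) - f xs)\<bar>
            \<le> K * \<bar>t\<bar> * (hderiv f E x - hderiv f (hfield us) xs) powr (1/4)"
        have "\<bar>increment f0 x us t - increment f0 xs us t\<bar>
             \<le> \<kappa> ((\<phi> x u + L \<bullet> u) - (\<phi> xs us + L \<bullet> us)) * \<bar>t\<bar>" if "\<bar>t\<bar> < 1" for t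
        proof -
          have "t \<in> {-1<..<1}" using that by auto
          moreover have "increment f0 x us t - increment f0 xs us t =
            (f (x + t *\<^sub>R hfield us x) - f x) - (f (xs + t *\<^sub>R hfield us xs) - f xs)"
            by (simp add: increment_def f_def inner_add_right)
          ultimately show ?thesis
            using 2 hf[OF xu] hf[OF xsD] by (auto simp: E \<kappa>_def mult_ac)
        qed
        then show "hderiv f E x < hderiv f (hfield us) xs + \<epsilon>"
          using \<delta>[rule_format, of x u] 1 xu hf[OF xu] hf[OF xsD] E by simp
      qed
    qed
  qed
qed

end
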